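(* Let $X$ be a finite-dimensional complex Banach space and let $T:X\to X$ be a diffeomorphism with fixed point $0$, having a power series around $0$, whose differential $T'(0)$ is diagonalizable with nonzero eigenvalues. Assume that the principle eigenfunctions of $U_{T'(0)}$ are non-resonant. Let $T_1=T$ and assume that we have, for some $m\ge1$, a map $T_m(x)=T'(0)x+R_{m+1}(x)$, where $R_{m+1}$ is a power series about $0$ and $R_{m+1}(x)\in\mathcal O(\|x\|^{m+1})$ as $x\to0$. Then there are a number $\epsilon_{m+1}$ with $0<\epsilon_{m+1}<1$ and an invertible polynomial map $\Phi_{m+1}:B_{\epsilon_{m+1}}\to\Phi_{m+1}(B_{\epsilon_{m+1}})$ of the form $x=\Phi_{m+1}(z)=(I_X+Q_{m+1})(z)$ with $Q_{m+1}\in\mathcal P({}^{m+1}X;X)$, such that for $z$ in a neighborhood of $0$ $$T_{m+1}(z):=(\Phi_{m+1}^{-1}\circ T_m\circ\Phi_{m+1})(z)=T'(0)z+R_{m+2}(z),$$ where $R_{m+2}$ is a power series about $0$ satisfying $R_{m+2}(z)\in\mathcal O(\|z\|^{m+2})$ as $z\to0$.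
   Context: $B_r=\{x\in X:\|x\|<r\}$, and $I_X$ is the identity on $X$. $\mathcal P({}^kX;X)$ is the space of continuous $k$-homogeneous polynomials $X\to X$, i.e. maps $x\mapsto A(x,\dots,x)$ with $A$ a $k$-linear map $X^k\to X$. A power series about $0$ is a function of the form $f(x)=\sum_{k=0}^\infty P_k(x)$ with $P_k\in\mathcal P({}^kX;X)$, converging near $0$. Let $n=\dim X$, $\{e_1,\dots,e_n\}$ a basis of eigenvectors, $T'(0)e_i=\lambda_ie_i$, with dual basis $\{\phi_1,\dots,\phi_n\}\subset X^*$; the $\phi_i$ are the principle eigenfunctions of the Koopman operator $U_{T'(0)}f=f\circ T'(0)$. They are non-resonant if $\lambda_j\ne\lambda_1^{\alpha_1}\cdots\lambda_n^{\alpha_n}$ for all $j\in\{1,\dots,n\}$ and all $\alpha\in\mathbb N_0^n$ with $|\alpha|=\alpha_1+\dots+\alpha_n\ge2$. *)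

theory Defs
  imports "HOL-Analysis.Analysis" "HOL-Library.Landau_Symbols"
begin

class complex_normed_vector = real_normed_vector +
  fixes scaleC :: "complex \<Rightarrow> 'a \<Rightarrow> 'a" (infixr \<open>*\<^sub>C\<close> 75)
  assumes scaleC_add_right: "a *\<^sub>C (x + y) = a *\<^sub>C x + a *\<^sub>C y"
    and scaleC_add_left: "(a + b) *\<^sub>C x = a *\<^sub>C x + b *\<^sub>C x"
    and scaleC_scaleC: "a *\<^sub>C (b *\<^sub>C x) = (a * b) *\<^sub>C x"
    and scaleC_one: "1 *\<^sub>C x = x"
    and scaleR_scaleC: "r *\<^sub>R x = complex_of_real r *\<^sub>C x"
    and norm_scaleC: "norm (a *\<^sub>C x) = cmod a * norm x"

global_interpretation complex_vector: vector_space "scaleC :: complex \<Rightarrow> 'a \<Rightarrow> 'a::complex_normed_vector"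
  by unfold_locales (simp_all add: scaleC_add_right scaleC_add_left scaleC_scaleC scaleC_one)

instantiation complex :: complex_normed_vector
begin

definition scaleC_complex :: "complex \<Rightarrow> complex \<Rightarrow> complex"
  where "scaleC_complex a x = a * x"

instance
  by standard
    (simp_all add: scaleC_complex_def algebra_simps norm_mult scaleR_conv_of_real)

end

abbreviation clinear :: "('a::complex_normed_vector \<Rightarrow> 'b::complex_normed_vector) \<Rightarrow> bool"
  where "clinear \<equiv> Vector_Spaces.linear scaleC scaleC"

definition bounded_clinear :: "('a::complex_normed_vector \<Rightarrow> 'b::complex_normed_vector) \<Rightarrow> bool"
  where "bounded_clinear f \<longleftrightarrow> clinear f \<and> bounded_linear f"

text \<open>The complex Frechet derivative: the library's \<open>has_derivative\<close> only makes \<open>D\<close> real-linear.\<close>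

definition has_cderivative_at ::
    "('a::complex_normed_vector \<Rightarrow> 'b::complex_normed_vector) \<Rightarrow> ('a \<Rightarrow> 'b) \<Rightarrow> 'a \<Rightarrow> bool"
  where "has_cderivative_at f D a \<longleftrightarrow> clinear D \<and> (f has_derivative D) (at a)"

text \<open>Differentiability is over the reals, so biholomorphic maps are included as a special case.\<close>

definition diffeomorphism :: "('a::real_normed_vector \<Rightarrow> 'a) \<Rightarrow> bool"
  where "diffeomorphism T \<longleftrightarrow> bij T \<and> T differentiable_on UNIV \<and> inv T differentiable_on UNIV"

text \<open>A \<open>k\<close>-tuple of vectors is encoded as a function on \<open>nat\<close> of which only the values at
  arguments below \<open>k\<close> matter; the first conjunct says that \<open>A\<close> ignores the other values.\<close>

definition multilinear_map ::
    "nat \<Rightarrow> ((nat \<Rightarrow> 'a::complex_normed_vector) \<Rightarrow> 'b::complex_normed_vector) \<Rightarrow> bool"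
  where "multilinear_map k A \<longleftrightarrow>
    (\<forall>v w. (\<forall>i<k. v i = w i) \<longrightarrow> A v = A w) \<and>
    (\<forall>i<k. \<forall>v. clinear (\<lambda>x. A (v(i := x))))"

definition hom_polys ::
    "nat \<Rightarrow> ('a::complex_normed_vector \<Rightarrow> 'b::complex_normed_vector) set"
  where "hom_polys k =
    {P. continuous_on UNIV P \<and> (\<exists>A. multilinear_map k A \<and> P = (\<lambda>x. A (\<lambda>_. x)))}"

definition has_power_series_at_0 ::
    "('a::complex_normed_vector \<Rightarrow> 'b::complex_normed_vector) \<Rightarrow> bool"
  where "has_power_series_at_0 f \<longleftrightarrow>
    (\<exists>P. (\<forall>k. P k \<in> hom_polys k) \<and> (\<forall>\<^sub>F x in nhds 0. (\<lambda>k. P k x) sums f x))"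

definition eigenbasis ::
    "('a::complex_normed_vector \<Rightarrow> 'a) \<Rightarrow> nat \<Rightarrow> (nat \<Rightarrow> 'a) \<Rightarrow> (nat \<Rightarrow> complex) \<Rightarrow> bool"
  where "eigenbasis L n e lam \<longleftrightarrow>
    inj_on e {1..n} \<and> complex_vector.independent (e ` {1..n}) \<and>
    complex_vector.span (e ` {1..n}) = UNIV \<and>
    (\<forall>i\<in>{1..n}. L (e i) = lam i *\<^sub>C e i)"

definition dual_basis ::
    "nat \<Rightarrow> (nat \<Rightarrow> 'a::complex_normed_vector) \<Rightarrow> (nat \<Rightarrow> 'a \<Rightarrow> complex) \<Rightarrow> bool"
  where "dual_basis n e \<phi> \<longleftrightarrow>
    (\<forall>i\<in>{1..n}. bounded_clinear (\<phi> i) \<and> (\<forall>j\<in>{1..n}. \<phi> i (e j) = (if i = j then 1 else 0)))"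

definition koopman :: "('a \<Rightarrow> 'a) \<Rightarrow> ('a \<Rightarrow> complex) \<Rightarrow> ('a \<Rightarrow> complex)"
  where "koopman L f = f \<circ> L"

definition eigenfunction ::
    "(('a \<Rightarrow> complex) \<Rightarrow> ('a \<Rightarrow> complex)) \<Rightarrow> complex \<Rightarrow> ('a \<Rightarrow> complex) \<Rightarrow> bool"
  where "eigenfunction U c f \<longleftrightarrow> f \<noteq> (\<lambda>_. 0) \<and> U f = (\<lambda>x. c * f x)"

text \<open>The eigenvalues \<open>mu\<close> are determined by \<open>U\<close> and \<open>\<phi>\<close>, as eigenfunctions are nonzero.\<close>

definition nonresonant_eigenfunctions ::
    "(('a \<Rightarrow> complex) \<Rightarrow> ('a \<Rightarrow> complex)) \<Rightarrow> nat \<Rightarrow> (nat \<Rightarrow> 'a \<Rightarrow> complex) \<Rightarrow> bool"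
  where "nonresonant_eigenfunctions U n \<phi> \<longleftrightarrow>
    (\<exists>mu. (\<forall>i\<in>{1..n}. eigenfunction U (mu i) (\<phi> i)) \<and>
      (\<forall>j\<in>{1..n}. \<forall>\<alpha>::nat \<Rightarrow> nat. (\<Sum>i=1..n. \<alpha> i) \<ge> 2 \<longrightarrow>
        mu j \<noteq> (\<Prod>i=1..n. mu i ^ \<alpha> i)))"

end

theory Submission
  imports Defs
begin

text \<open>
  Let \<open>P\<close> be the homogeneous part of degree \<open>m + 1\<close> of \<open>R\<close>; the lower ones vanish by the growth
  condition. In the coordinates \<open>\<phi>\<close> the operator \<open>Q \<mapsto> Q \<circ> D - D \<circ> Q\<close> is diagonal on
  monomial maps, with eigenvalues that are nonzero by non-resonance, so \<open>Q \<circ> D - D \<circ> Q = P\<close> has a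
  solution. With \<open>\<Phi> = I + Q\<close> one gets \<open>T\<^sub>m (\<Phi> z) - \<Phi> (D z) = R (\<Phi> z) - P z\<close>, which is of order
  \<open>m + 2\<close>, and so is \<open>R'\<close> because \<open>\<Phi>\<close> has a Lipschitz inverse.

  That \<open>R'\<close> is again a power series needs no complex analysis: near the origin the maps given by a
  power series are exactly the uniform limits of polynomial maps, a class closed under
  composition and containing \<open>\<Phi>\<close>'s inverse. Cauchy's estimates are replaced by finite averages over
  roots of unity.
\<close>

section \<open>Homogeneous polynomials in coordinates\<close>

text \<open>The obstacle is that \<open>has_power_series_at_0\<close> promises pointwise convergence
  only; uniform bounds on the terms have to be extracted, which is the purpose of the Baire
  argument. In the other direction, approximating polynomials may have unbounded degrees, so
  estimates must not depend on the degree: averaging bounds each homogeneous component with constant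
  1. Uniform approximation is preferred to series because composing two series means rearranging a
  multiple sum, whereas composing approximations needs only a Lipschitz bound for polynomials. The
  assumption \<open>m \<ge> 1\<close> enters three times: degree \<open>m + 1\<close> is at least 2,
  so non-resonance applies and \<open>Q\<close> contracts near the origin, and
  \<open>2 * m + 1 \<ge> m + 2\<close> makes the change from \<open>P (\<Phi> z)\<close> to
  \<open>P z\<close> negligible.\<close>

lemma bounded_bilinear_scaleC:
  "bounded_bilinear (scaleC :: complex \<Rightarrow> 'a \<Rightarrow> 'a::complex_normed_vector)"
proof
  show "(r *\<^sub>R a) *\<^sub>C b = r *\<^sub>R (a *\<^sub>C b)" for r a and b :: 'a
    by (simp add: scaleR_scaleC[of r "a *\<^sub>C b"] scaleC_scaleC scaleR_conv_of_real)
  show "a *\<^sub>C (r *\<^sub>R b) = r *\<^sub>R (a *\<^sub>C b)" for r a and b :: 'a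
    by (simp add: scaleR_scaleC[of r "a *\<^sub>C b"] scaleR_scaleC[of r b] scaleC_scaleC mult.commute)
qed (auto simp: scaleC_add_left scaleC_add_right norm_scaleC intro!: exI[of _ 1])

lemma tendsto_scaleC [tendsto_intros]:
  fixes g :: "'b \<Rightarrow> 'a::complex_normed_vector"
  shows "(f \<longlongrightarrow> a) F \<Longrightarrow> (g \<longlongrightarrow> b) F \<Longrightarrow> ((\<lambda>x. f x *\<^sub>C g x) \<longlongrightarrow> a *\<^sub>C b) F"
  by (rule bounded_bilinear.tendsto[OF bounded_bilinear_scaleC])

lemma continuous_on_scaleC [continuous_intros]:
  fixes g :: "'b::topological_space \<Rightarrow> 'a::complex_normed_vector"
  shows "continuous_on S f \<Longrightarrow> continuous_on S g \<Longrightarrow> continuous_on S (\<lambda>x. f x *\<^sub>C g x)"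
  by (rule bounded_bilinear.continuous_on[OF bounded_bilinear_scaleC])

lemma clinear_iff:
  "clinear f \<longleftrightarrow> (\<forall>x y. f (x + y) = f x + f y) \<and> (\<forall>c x. f (c *\<^sub>C x) = c *\<^sub>C f x)"
  by (auto simp: Vector_Spaces.linear_iff complex_vector.vector_space_axioms)

lemma clinear_sum: "clinear f \<Longrightarrow> f (sum g A) = (\<Sum>i\<in>A. f (g i))"
  by (rule module_hom.sum) (rule Vector_Spaces.linear.axioms(3))

lemma hom_polysI:
  assumes "continuous_on UNIV P" "multilinear_map k A" "\<And>x. P x = A (\<lambda>_. x)"
  shows "P \<in> hom_polys k"
  using assms by (auto simp: hom_polys_def)

lemma hom_polys_zero: "(\<lambda>_. 0) \<in> hom_polys k"
  by (rule hom_polysI[where A = "\<lambda>_. 0"]) (auto simp: multilinear_map_def clinear_iff)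

lemma hom_polys_add:
  assumes "P \<in> hom_polys k" "Q \<in> hom_polys k"
  shows "(\<lambda>x. P x + Q x) \<in> hom_polys k"
proof -
  obtain A where A: "continuous_on UNIV P" "multilinear_map k A" "P = (\<lambda>x. A (\<lambda>_. x))"
    using assms(1) by (auto simp: hom_polys_def)
  obtain B where B: "continuous_on UNIV Q" "multilinear_map k B" "Q = (\<lambda>x. B (\<lambda>_. x))"
    using assms(2) by (auto simp: hom_polys_def)
  have "multilinear_map k (\<lambda>v. A v + B v)"
    unfolding multilinear_map_def
  proof (intro conjI allI impI)
    fix v w :: "nat \<Rightarrow> 'a" assume "\<forall>i<k. v i = w i"
    then have "A v = A w" "B v = B w"
      using A(2) B(2) unfolding multilinear_map_def by blast+
    then show "A v + B v = A w + B w" by simp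
  next
    fix i and v :: "nat \<Rightarrow> 'a" assume "i < k"
    then show "clinear (\<lambda>x. A (v(i := x)) + B (v(i := x)))"
      using A(2) B(2) by (simp add: multilinear_map_def clinear_iff scaleC_add_right)
  qed
  with A B show ?thesis
    by (intro hom_polysI[where A = "\<lambda>v. A v + B v"] continuous_intros) auto
qed

lemma prod_list_map_eq_prod_count:
  fixes g :: "'a \<Rightarrow> 'b::comm_monoid_mult"
  assumes "finite S" "set xs \<subseteq> S"
  shows "prod_list (map g xs) = (\<Prod>i\<in>S. g i ^ count_list xs i)"
  using assms(2)
proof (induction xs)
  case (Cons a xs)
  have "(\<Prod>i\<in>S. g i ^ count_list (a # xs) i)
      = (\<Prod>i\<in>S. (if i = a then g a else 1) * g i ^ count_list xs i)"
    by (intro prod.cong) auto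
  also have "\<dots> = g a * (\<Prod>i\<in>S. g i ^ count_list xs i)"
    using Cons.prems assms(1) by (simp add: prod.distrib)
  finally show ?case
    using Cons by simp
qed simp

text \<open>The bounded functionals link the arbitrary norm to polynomial expressions: continuity
  and Lipschitz bounds are inherited from \<open>\<phi>\<close>.\<close>

locale dual_coordinates =
  fixes n :: nat and e :: "nat \<Rightarrow> 'a::{complex_normed_vector, banach}" and \<phi> :: "nat \<Rightarrow> 'a \<Rightarrow> complex"
  assumes dual: "dual_basis n e \<phi>"
    and expand: "x = (\<Sum>i=1..n. \<phi> i x *\<^sub>C e i)"
begin

lemma phi_add: "i \<in> {1..n} \<Longrightarrow> \<phi> i (x + y) = \<phi> i x + \<phi> i y"
  and phi_scale: "i \<in> {1..n} \<Longrightarrow> \<phi> i (c *\<^sub>C x) = c * \<phi> i x"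
  and bounded_linear_phi: "i \<in> {1..n} \<Longrightarrow> bounded_linear (\<phi> i)"
  and phi_basis: "i \<in> {1..n} \<Longrightarrow> j \<in> {1..n} \<Longrightarrow> \<phi> i (e j) = (if i = j then 1 else 0)"
  using dual by (auto simp: dual_basis_def bounded_clinear_def clinear_iff scaleC_complex_def)

lemma continuous_on_phi [continuous_intros]: "i \<in> {1..n} \<Longrightarrow> continuous_on S (\<phi> i)"
  by (intro linear_continuous_on bounded_linear_phi)

lemma phi_coords: "i \<in> {1..n} \<Longrightarrow> \<phi> i (\<Sum>j=1..n. c j *\<^sub>C e j) = c i"
proof -
  assume i: "i \<in> {1..n}"
  have "\<phi> i (\<Sum>j=1..n. c j *\<^sub>C e j) = (\<Sum>j=1..n. \<phi> i (c j *\<^sub>C e j))"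
    using bounded_linear_phi[OF i] by (simp add: bounded_linear.linear linear_sum)
  also have "\<dots> = (\<Sum>j=1..n. if j = i then c j else 0)"
    using i by (intro sum.cong) (auto simp: phi_scale phi_basis)
  finally show ?thesis using i by simp
qed

text \<open>A list of indices instead of a multi-index: products become concatenations, and
  positions serve as the slots of a multilinear map. Exponents are recovered by
  \<open>count_list\<close>.\<close>

definition monomial :: "nat list \<Rightarrow> 'a \<Rightarrow> complex"
  where "monomial xs x = prod_list (map (\<lambda>i. \<phi> i x) xs)"

lemma monomial_simps [simp]:
  "monomial [] x = 1" "monomial (i # xs) x = \<phi> i x * monomial xs x"
  "monomial (xs @ ys) x = monomial xs x * monomial ys x"
  by (auto simp: monomial_def)

lemma monomial_scale: "set xs \<subseteq> {1..n} \<Longrightarrow> monomial xs (c *\<^sub>C x) = c ^ length xs * monomial xs x"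
  by (induction xs) (auto simp: phi_scale)

lemma continuous_on_monomial [continuous_intros]:
  "set xs \<subseteq> {1..n} \<Longrightarrow> continuous_on S (monomial xs)"
  by (induction xs) (auto simp: monomial_def intro!: continuous_intros)

text \<open>An inductive description of \<open>hom_polys k\<close> (the two inclusions are
  \<open>hpoly_imp_hom_polys\<close> and \<open>hom_polys_imp_hpoly\<close>), which reduces claims
  to single monomials with a vector coefficient.\<close>

inductive hpoly :: "nat \<Rightarrow> ('a \<Rightarrow> 'b::complex_normed_vector) \<Rightarrow> bool" where
  hpoly_zero: "hpoly k (\<lambda>_. 0)"
| hpoly_monomial: "set xs \<subseteq> {1..n} \<Longrightarrow> length xs = k \<Longrightarrow> hpoly k (\<lambda>x. monomial xs x *\<^sub>C c)"
| hpoly_add: "hpoly k f \<Longrightarrow> hpoly k g \<Longrightarrow> hpoly k (\<lambda>x. f x + g x)"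

lemma hpoly_sum: "(\<And>i. i \<in> I \<Longrightarrow> hpoly k (f i)) \<Longrightarrow> hpoly k (\<lambda>x. \<Sum>i\<in>I. f i x)"
  by (induction I rule: infinite_finite_induct) (auto intro: hpoly_zero hpoly_add)

lemma hpoly_homogeneous: "hpoly k f \<Longrightarrow> f (c *\<^sub>C x) = c ^ k *\<^sub>C f x"
  by (induction rule: hpoly.induct) (auto simp: monomial_scale scaleC_add_right scaleC_scaleC)

lemma hpoly_mult_phi:
  assumes "hpoly k f" "i \<in> {1..n}" shows "hpoly (Suc k) (\<lambda>x. \<phi> i x *\<^sub>C f x)"
  using assms
proof (induction rule: hpoly.induct)
  case (hpoly_monomial xs k c)
  then show ?case
    using hpoly.hpoly_monomial[of "i # xs" "Suc k" c] by (simp add: scaleC_scaleC)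
qed (auto simp: scaleC_add_right intro: hpoly.intros)

lemma multilinear_map_monomial:
  assumes "set xs \<subseteq> {1..n}"
  shows "multilinear_map (length xs) (\<lambda>v. (\<Prod>i<length xs. \<phi> (xs ! i) (v i)) *\<^sub>C c)"
  unfolding multilinear_map_def
proof (intro conjI allI impI)
  fix v w :: "nat \<Rightarrow> 'a" assume "\<forall>i<length xs. v i = w i"
  then show "(\<Prod>i<length xs. \<phi> (xs ! i) (v i)) *\<^sub>C c = (\<Prod>i<length xs. \<phi> (xs ! i) (w i)) *\<^sub>C c"
    by simp
next
  fix j and v :: "nat \<Rightarrow> 'a" assume j: "j < length xs"
  then have xj: "xs ! j \<in> {1..n}" using assms nth_mem by blast
  have *: "(\<Prod>i<length xs. \<phi> (xs ! i) ((v(j := x)) i))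
      = \<phi> (xs ! j) x * (\<Prod>i\<in>{..<length xs} - {j}. \<phi> (xs ! i) (v i))" for x
    using j by (subst prod.remove[of _ j]) auto
  show "clinear (\<lambda>x. (\<Prod>i<length xs. \<phi> (xs ! i) ((v(j := x)) i)) *\<^sub>C c)"
    unfolding clinear_iff *
    using xj by (simp add: phi_add phi_scale distrib_right scaleC_add_left scaleC_scaleC mult_ac)
qed

lemma hpoly_imp_hom_polys: "hpoly k f \<Longrightarrow> f \<in> hom_polys k"
proof (induction rule: hpoly.induct)
  case (hpoly_monomial xs k c)
  show ?case
  proof (rule hom_polysI)
    show "continuous_on UNIV (\<lambda>x. monomial xs x *\<^sub>C c)"
      using hpoly_monomial by (intro continuous_intros)
    show "multilinear_map k (\<lambda>v. (\<Prod>i<k. \<phi> (xs ! i) (v i)) *\<^sub>C c)"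
      using multilinear_map_monomial[of xs c] hpoly_monomial by simp
    show "monomial xs x *\<^sub>C c = (\<Prod>i<k. \<phi> (xs ! i) x) *\<^sub>C c" for x
      using hpoly_monomial by (simp add: monomial_def prod.list_conv_set_nth atLeast0LessThan)
  qed
qed (auto intro: hom_polys_zero hom_polys_add)

text \<open>The variable is moved into the slots of \<open>A\<close> one at a time; each new slot is
  expanded in the basis, which multiplies by one coordinate.\<close>

lemma hom_polys_imp_hpoly:
  assumes "f \<in> hom_polys k" shows "hpoly k f"
proof -
  obtain A where A: "multilinear_map k A" "f = (\<lambda>x. A (\<lambda>_. x))"
    using assms by (auto simp: hom_polys_def)
  \<comment> \<open>Slots from \<open>j\<close> on are frozen at \<open>v\<close>, which must vary
    because the induction step freezes slot \<open>j\<close> at basis vectors.\<close>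
  have "hpoly j (\<lambda>x. A (\<lambda>i. if i < j then x else v i))" if "j \<le> k" for j v
    using that
  proof (induction j arbitrary: v)
    case 0
    then show ?case using hpoly_monomial[of "[]" 0 "A v"] by (simp add: scaleC_one)
  next
    case (Suc j)
    have "A (\<lambda>i. if i < Suc j then x else v i)
        = (\<Sum>l=1..n. \<phi> l x *\<^sub>C A (\<lambda>i. if i < j then x else (v(j := e l)) i))" for x
    proof -
      define w where "w = (\<lambda>i. if i < j then x else v i)"
      have lin: "clinear (\<lambda>x. A (w(j := x)))"
        using A(1) Suc.prems by (auto simp: multilinear_map_def)
      have upd: "w(j := y) = (\<lambda>i. if i < j then x else (v(j := y)) i)" for y
        by (auto simp: w_def)
      have "(\<lambda>i. if i < Suc j then x else v i) = w(j := \<Sum>l=1..n. \<phi> l x *\<^sub>C e l)"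
        unfolding expand[of x, symmetric] by (auto simp: w_def)
      then have "A (\<lambda>i. if i < Suc j then x else v i) = A (w(j := \<Sum>l=1..n. \<phi> l x *\<^sub>C e l))"
        by simp
      also have "\<dots> = (\<Sum>l=1..n. \<phi> l x *\<^sub>C A (w(j := e l)))"
        using clinear_sum[OF lin, of "\<lambda>l. \<phi> l x *\<^sub>C e l" "{1..n}"] lin by (simp add: clinear_iff)
      finally show ?thesis by (simp add: upd)
    qed
    then show ?case
      using Suc by (auto intro!: hpoly_sum hpoly_mult_phi)
  qed
  \<comment> \<open>\<open>undefined\<close> fills the slots from \<open>k\<close> on, which
    \<open>A\<close> ignores.\<close>
  from this[of k "\<lambda>_. undefined"] have "hpoly k (\<lambda>x. A (\<lambda>i. if i < k then x else undefined))" by simp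
  moreover have "A (\<lambda>i. if i < k then x else undefined) = A (\<lambda>_. x)" for x
    using A(1) by (auto simp: multilinear_map_def)
  ultimately show ?thesis using A(2) by simp
qed

end

lemma dual_coordinatesI:
  assumes "dual_basis n e \<phi>" "complex_vector.span (e ` {1..n}) = UNIV"
  shows "dual_coordinates n e \<phi>"
proof
  fix x
  have lin: "\<phi> i (x + y) = \<phi> i x + \<phi> i y" "\<phi> i (c *\<^sub>C x) = c * \<phi> i x" "\<phi> i 0 = 0"
    if "i \<in> {1..n}" for i x y c
  proof -
    have "clinear (\<phi> i)" using assms(1) that by (auto simp: dual_basis_def bounded_clinear_def)
    then show add: "\<phi> i (x + y) = \<phi> i x + \<phi> i y" and "\<phi> i (c *\<^sub>C x) = c * \<phi> i x" for x y
      by (auto simp: clinear_iff scaleC_complex_def)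
    show "\<phi> i 0 = 0" using add[of 0 0] by simp
  qed
  have "x \<in> complex_vector.span (e ` {1..n})" using assms(2) by simp
  then show "x = (\<Sum>i=1..n. \<phi> i x *\<^sub>C e i)"
  proof (induction rule: complex_vector.span_induct_alt)
    case base
    then show ?case using lin(3) by simp
  next
    case (step c b y)
    then obtain j where j: "j \<in> {1..n}" "b = e j" by blast
    have "(\<Sum>i=1..n. \<phi> i (c *\<^sub>C b + y) *\<^sub>C e i)
        = (\<Sum>i=1..n. (if i = j then c *\<^sub>C e j else 0) + \<phi> i y *\<^sub>C e i)"
      using assms(1) j lin(1,2) by (intro sum.cong) (auto simp: dual_basis_def scaleC_add_left)
    then show ?case using j step.IH by (simp add: sum.distrib)
  qed
qed (rule assms(1))

section \<open>Averaging over roots of unity\<close>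

definition unity_root :: "nat \<Rightarrow> nat \<Rightarrow> complex"
  where "unity_root N j = cis (2 * pi * real j / real N)"

lemma norm_unity_root [simp]: "cmod (unity_root N j) = 1"
  by (simp add: unity_root_def)

lemma unity_root_nonzero [simp]: "unity_root N j \<noteq> 0"
  by (simp add: unity_root_def)

text \<open>Index and exponent play symmetric roles in \<open>unity_root\<close>, so this is the
  geometric series of an \<open>N\<close>-th root of unity \<open>z\<close>, and
  \<open>z = 1\<close> only for \<open>a = b\<close> as both lie below \<open>N\<close>.\<close>

lemma unity_root_orthogonality:
  assumes "a < N" "b < N"
  shows "(\<Sum>j<N. unity_root N j ^ a * inverse (unity_root N j) ^ b)
    = (if a = b then of_nat N else 0)"
proof -
  define z where "z = unity_root N a / unity_root N b"
  have swap: "unity_root N c ^ j = unity_root N j ^ c" for c j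
    unfolding unity_root_def Complex.DeMoivre by (simp add: mult_ac)
  have "z ^ j = unity_root N j ^ a * inverse (unity_root N j) ^ b" for j
    by (simp add: z_def divide_inverse power_mult_distrib power_inverse swap[of a j] swap[of b j])
  then have *: "(\<Sum>j<N. unity_root N j ^ a * inverse (unity_root N j) ^ b) = (\<Sum>j<N. z ^ j)"
    by simp
  show ?thesis
  proof (cases "a = b")
    case True
    then show ?thesis unfolding * by (simp add: z_def)
  next
    case False
    have "inj_on (unity_root N) {..<N}"
      unfolding unity_root_def[abs_def] using Complex.bij_betw_roots_unity[of N] assms
      by (intro bij_betw_imp_inj_on) simp
    then have "unity_root N a \<noteq> unity_root N b"
      using assms False by (auto dest: inj_onD)
    then have "z \<noteq> 1" by (simp add: z_def)
    moreover have "unity_root N j ^ N = 1" for j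
      using assms by (simp add: unity_root_def Complex.DeMoivre cis_multiple_2pi)
    then have "z ^ N = 1" by (simp add: z_def power_divide)
    ultimately show ?thesis using False by (simp add: * geometric_sum)
  qed
qed

text \<open>A discrete Fourier coefficient: exact, without any integral, because all frequencies lie
  below \<open>N\<close>. The vanishing above \<open>d\<close> settles the case
  \<open>k > d\<close>.\<close>

lemma unity_root_average:
  fixes v :: "nat \<Rightarrow> 'b::complex_normed_vector"
  assumes "d < N" "k < N" "\<And>l. l > d \<Longrightarrow> v l = 0"
  shows "v k = (\<Sum>j<N. (inverse (unity_root N j) ^ k / of_nat N) *\<^sub>C
    (\<Sum>l\<le>d. unity_root N j ^ l *\<^sub>C v l))"
proof -
  have "(\<Sum>j<N. (inverse (unity_root N j) ^ k / of_nat N) *\<^sub>C (\<Sum>l\<le>d. unity_root N j ^ l *\<^sub>C v l))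
      = (\<Sum>l\<le>d. (\<Sum>j<N. unity_root N j ^ l * inverse (unity_root N j) ^ k / of_nat N) *\<^sub>C v l)"
    unfolding complex_vector.scale_sum_right complex_vector.scale_sum_left
    by (subst sum.swap) (simp add: scaleC_scaleC mult_ac)
  also have "\<dots> = (\<Sum>l\<le>d. if l = k then v l else 0)"
    using assms unity_root_orthogonality[of _ N k]
    by (intro sum.cong) (auto simp: sum_divide_distrib[symmetric] scaleC_one)
  also have "\<dots> = v k" using assms(3)[of k] by auto
  finally show ?thesis by simp
qed

text \<open>The Lagrange basis polynomial for the node \<open>unity_root N j\<close> among the
  \<open>N\<close>-th roots of unity, written as a geometric sum.\<close>

definition interpolant :: "nat \<Rightarrow> nat \<Rightarrow> complex \<Rightarrow> complex"
  where "interpolant N j t = (\<Sum>a<N. t ^ a * inverse (unity_root N j) ^ a / of_nat N)"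

lemma interpolant_reproduces_power:
  assumes "c < N"
  shows "(\<Sum>j<N. unity_root N j ^ c * interpolant N j t) = t ^ c"
proof -
  have "(\<Sum>j<N. unity_root N j ^ c * interpolant N j t)
      = (\<Sum>a<N. \<Sum>j<N. t ^ a / of_nat N * (unity_root N j ^ c * inverse (unity_root N j) ^ a))"
    unfolding interpolant_def sum_distrib_left
    by (subst sum.swap) (intro sum.cong refl, simp)
  also have "\<dots> = (\<Sum>a<N. t ^ a / of_nat N * (if c = a then of_nat N else 0))"
    unfolding sum_distrib_left[symmetric]
    by (intro sum.cong refl arg_cong2[of _ _ _ _ "(*)"] unity_root_orthogonality assms) simp
  also have "\<dots> = (\<Sum>a<N. if a = c then t ^ a else 0)"
    by (intro sum.cong) auto
  finally show ?thesis using assms by simp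
qed

text \<open>Lets facts about homogeneous maps on a ball be carried to every point by
  rescaling.\<close>

lemma ball_absorbing:
  fixes x :: "'a::real_normed_vector"
  assumes "r > 0"
  obtains t where "t > 0" "t *\<^sub>R x \<in> ball 0 r"
proof -
  define t where "t = r / (2 * (norm x + 1))"
  have t: "t > 0" using assms by (simp add: t_def add_nonneg_pos)
  have "t * norm x = r * (norm x / (2 * (norm x + 1)))" by (simp add: t_def)
  also have "\<dots> < r * 1"
    using assms by (intro mult_strict_left_mono) (auto simp: divide_simps add_nonneg_pos)
  finally have "t *\<^sub>R x \<in> ball 0 r" using t by simp
  then show ?thesis using that t by blast
qed

text \<open>Each factor is bounded on the ball by its value at 0 plus Lipschitz constant times
  radius; a negative radius is treated apart since 0 then lies outside the ball.\<close>

lemma lipschitz_on_scaleC: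
  fixes s :: "'a::real_normed_vector \<Rightarrow> complex" and f :: "'a \<Rightarrow> 'b::complex_normed_vector"
  assumes s: "L-lipschitz_on (cball 0 r) s" and f: "M-lipschitz_on (cball 0 r) f"
  shows "\<exists>K. K-lipschitz_on (cball 0 r) (\<lambda>x. s x *\<^sub>C f x)"
proof (cases "r \<ge> 0")
  case True
  have L: "L \<ge> 0" and M: "M \<ge> 0" using s f by (auto dest: lipschitz_on_nonneg)
  have bound: "norm (g x) \<le> norm (g 0) + K * r"
    if "K-lipschitz_on (cball 0 r) g" "x \<in> cball 0 r"
    for g :: "'a \<Rightarrow> 'c::real_normed_vector" and K x
  proof -
    have K: "K \<ge> 0" using that(1) by (rule lipschitz_on_nonneg)
    have "norm (g x - g 0) \<le> K * norm (x - 0)"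
      using lipschitz_onD[OF that(1), of x 0] that(2) True by (simp add: dist_norm)
    also have "\<dots> \<le> K * r" using K that(2) by (simp add: mult_left_mono)
    finally show ?thesis using norm_triangle_sub[of "g x" "g 0"] by linarith
  qed
  have "dist (s x *\<^sub>C f x) (s y *\<^sub>C f y)
      \<le> ((norm (s 0) + L * r) * M + L * (norm (f 0) + M * r)) * dist x y"
    if "x \<in> cball 0 r" "y \<in> cball 0 r" for x y
  proof -
    have "s x *\<^sub>C f x - s y *\<^sub>C f y = s x *\<^sub>C (f x - f y) + (s x - s y) *\<^sub>C f y"
      by (simp add: complex_vector.scale_right_diff_distrib complex_vector.scale_left_diff_distrib)
    then have "dist (s x *\<^sub>C f x) (s y *\<^sub>C f y)
        \<le> norm (s x) * norm (f x - f y) + norm (s x - s y) * norm (f y)"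
      unfolding dist_norm by (metis norm_triangle_ineq norm_scaleC)
    also have "\<dots> \<le> (norm (s 0) + L * r) * (M * dist x y) + (L * dist x y) * (norm (f 0) + M * r)"
      using lipschitz_onD[OF s that] lipschitz_onD[OF f that] bound[OF s that(1)] bound[OF f that(2)]
        L M True
      by (intro add_mono mult_mono) (auto simp: dist_norm)
    finally show ?thesis by (simp add: algebra_simps)
  qed
  then show ?thesis
    using L M True
    by (intro exI[of _ "(norm (s 0) + L * r) * M + L * (norm (f 0) + M * r)"] lipschitz_onI) auto
next
  case False
  then show ?thesis by (intro exI[of _ 0] lipschitz_onI) auto
qed

section \<open>Polynomial maps and their homogeneous components\<close>

context dual_coordinates
begin

text \<open>Degrees are left out to make products and composition simple inductions;
  \<open>polymap_components\<close> recovers them.\<close>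

inductive polymap :: "('a \<Rightarrow> 'b::complex_normed_vector) \<Rightarrow> bool" where
  polymap_const: "polymap (\<lambda>_. c)"
| polymap_mult_phi: "i \<in> {1..n} \<Longrightarrow> polymap f \<Longrightarrow> polymap (\<lambda>x. \<phi> i x *\<^sub>C f x)"
| polymap_add: "polymap f \<Longrightarrow> polymap g \<Longrightarrow> polymap (\<lambda>x. f x + g x)"

lemma polymap_sum: "(\<And>i. i \<in> I \<Longrightarrow> polymap (f i)) \<Longrightarrow> polymap (\<lambda>x. \<Sum>i\<in>I. f i x)"
  by (induction I rule: infinite_finite_induct) (auto intro: polymap_const polymap_add)

lemma polymap_cscale: "polymap f \<Longrightarrow> polymap (\<lambda>x. c *\<^sub>C f x)"
proof (induction rule: polymap.induct)
  case (polymap_mult_phi i f)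
  then show ?case
    using polymap.polymap_mult_phi[of i "\<lambda>x. c *\<^sub>C f x"] by (simp add: scaleC_scaleC mult.commute)
qed (auto simp: scaleC_add_right intro: polymap.intros)

lemma polymap_mult:
  fixes s :: "'a \<Rightarrow> complex"
  shows "polymap s \<Longrightarrow> polymap f \<Longrightarrow> polymap (\<lambda>x. s x *\<^sub>C f x)"
proof (induction s rule: polymap.induct)
  case (polymap_mult_phi i s)
  then show ?case
    using polymap.polymap_mult_phi[of i "\<lambda>x. s x *\<^sub>C f x"]
    by (simp add: scaleC_scaleC scaleC_complex_def)
qed (auto simp: scaleC_add_left intro: polymap.intros polymap_cscale)

lemma polymap_diff: "polymap f \<Longrightarrow> polymap g \<Longrightarrow> polymap (\<lambda>x. f x - g x)"
  using polymap_add[of f "\<lambda>x. (-1) *\<^sub>C g x"] polymap_cscale[of g "-1"]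
  by (simp add: scaleC_one)

lemma polymap_phi: "i \<in> {1..n} \<Longrightarrow> polymap (\<phi> i)"
  using polymap_mult_phi[of i "\<lambda>_. 1::complex"] polymap_const[of "1::complex"]
  by (simp add: scaleC_complex_def)

lemma polymap_id: "polymap (\<lambda>x. x)"
proof -
  have "polymap (\<lambda>x. \<Sum>i=1..n. \<phi> i x *\<^sub>C e i)"
    by (intro polymap_sum polymap_mult_phi polymap_const)
  then show ?thesis by (simp only: expand[symmetric])
qed

lemma polymap_prod:
  fixes s :: "'c \<Rightarrow> 'a \<Rightarrow> complex"
  shows "(\<And>i. i \<in> I \<Longrightarrow> polymap (s i)) \<Longrightarrow> polymap (\<lambda>x. \<Prod>i\<in>I. s i x)"
  by (induction I rule: infinite_finite_induct)
    (auto intro: polymap_const polymap_mult simp flip: scaleC_complex_def)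

lemma polymap_power:
  fixes s :: "'a \<Rightarrow> complex"
  shows "polymap s \<Longrightarrow> polymap (\<lambda>x. s x ^ k)"
  using polymap_prod[of "{..<k}" "\<lambda>_. s"] by simp

lemma hpoly_imp_polymap: "hpoly k f \<Longrightarrow> polymap f"
proof (induction rule: hpoly.induct)
  case (hpoly_monomial xs k c)
  have "polymap (\<lambda>x. monomial xs x *\<^sub>C c)"
    using hpoly_monomial(1)
  proof (induction xs)
    case (Cons i xs)
    then show ?case using polymap_mult_phi[of i "\<lambda>x. monomial xs x *\<^sub>C c"] by (simp add: scaleC_scaleC)
  qed (simp add: polymap_const)
  then show ?case .
qed (auto intro: polymap.intros)

lemma polymap_compose:
  assumes "polymap f" "polymap g" shows "polymap (\<lambda>x. f (g x))"
  using assms(1)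
proof (induction rule: polymap.induct)
  case (polymap_mult_phi i f)
  \<comment> \<open>An inner induction over \<open>g\<close>: since \<open>\<phi> i\<close> is
    linear, it only turns the coefficients of \<open>g\<close> into scalars.\<close>
  have "polymap (\<lambda>x. \<phi> i (g x))"
    using assms(2)
  proof (induction rule: polymap.induct)
    case (polymap_mult_phi j h)
    then show ?case
      using polymap.polymap_mult_phi[of j "\<lambda>x. \<phi> i (h x)"] \<open>i \<in> {1..n}\<close>
      by (simp add: phi_scale scaleC_complex_def)
  qed (use \<open>i \<in> {1..n}\<close> in \<open>auto simp: phi_add intro: polymap.intros\<close>)
  with polymap_mult_phi show ?case by (intro polymap_mult)
qed (auto intro: polymap.intros)

lemma polymap_lipschitz: "polymap f \<Longrightarrow> \<exists>L. L-lipschitz_on (cball 0 r) f"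
proof (induction rule: polymap.induct)
  case (polymap_const c)
  then show ?case by (intro exI[of _ 0] lipschitz_onI) auto
next
  case (polymap_mult_phi i f)
  then obtain M where "M-lipschitz_on (cball 0 r) f" by blast
  moreover from bounded_linear.lipschitz_boundE[OF bounded_linear_phi[OF polymap_mult_phi(1)]]
  obtain L where "L-lipschitz_on (cball 0 r) (\<phi> i)" by blast
  ultimately show ?case by (rule lipschitz_on_scaleC[rotated])
next
  case (polymap_add f g)
  then show ?case by (blast intro: lipschitz_on_add)
qed

text \<open>The components form an infinite family vanishing beyond \<open>d\<close>, so two
  decompositions can be padded to a common degree before being added or subtracted.\<close>

lemma polymap_components:
  assumes "polymap f"
  shows "\<exists>d P. (\<forall>k. hpoly k (P k)) \<and> (\<forall>k>d. \<forall>x. P k x = 0) \<and> (\<forall>x. f x = (\<Sum>k\<le>d. P k x))"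
  using assms
proof (induction rule: polymap.induct)
  case (polymap_const c)
  have "hpoly 0 (\<lambda>x. c)" using hpoly_monomial[of "[]" 0 c] by (simp add: scaleC_one)
  then show ?case
    by (intro exI[of _ 0] exI[of _ "\<lambda>k x. if k = 0 then c else 0"]) (auto intro: hpoly_zero)
next
  case (polymap_mult_phi i f)
  then obtain d P where P: "\<And>k. hpoly k (P k)" "\<And>k x. k > d \<Longrightarrow> P k x = 0" "\<And>x. f x = (\<Sum>k\<le>d. P k x)"
    by blast
  define P' where "P' k = (case k of 0 \<Rightarrow> \<lambda>_. 0 | Suc k \<Rightarrow> \<lambda>x. \<phi> i x *\<^sub>C P k x)" for k
  have "hpoly k (P' k)" for k
    using hpoly_mult_phi[OF P(1) polymap_mult_phi(1)] by (cases k) (simp_all add: P'_def hpoly_zero)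
  moreover have "P' k x = 0" if "k > Suc d" for k x
    using that P(2) by (cases k) (auto simp: P'_def)
  moreover have "\<phi> i x *\<^sub>C f x = (\<Sum>k\<le>Suc d. P' k x)" for x
    by (simp add: sum.atMost_Suc_shift P'_def P(3) complex_vector.scale_sum_right del: sum.atMost_Suc)
  ultimately show ?case by blast
next
  case (polymap_add f g)
  then obtain d P where P: "\<And>k. hpoly k (P k)" "\<And>k x. k > d \<Longrightarrow> P k x = 0" "\<And>x. f x = (\<Sum>k\<le>d. P k x)"
    by blast
  obtain d' P' where P': "\<And>k. hpoly k (P' k)" "\<And>k x. k > d' \<Longrightarrow> P' k x = 0" "\<And>x. g x = (\<Sum>k\<le>d'. P' k x)"
    using polymap_add by blast
  have "f x = (\<Sum>k\<le>max d d'. P k x)" "g x = (\<Sum>k\<le>max d d'. P' k x)" for x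
    unfolding P(3) P'(3) by (rule sum.mono_neutral_left; use P(2) P'(2) in auto)+
  then show ?case
    using P P' by (intro exI[of _ "max d d'"] exI[of _ "\<lambda>k x. P k x + P' k x"])
      (auto simp: sum.distrib intro: hpoly_add)
qed

lemma component_average:
  assumes "\<And>k. hpoly k (P k)" "\<And>k x. k > d \<Longrightarrow> P k x = 0" "\<And>x. f x = (\<Sum>k\<le>d. P k x)"
    "d < N" "k < N"
  shows "P k x = (\<Sum>j<N. (inverse (unity_root N j) ^ k / of_nat N) *\<^sub>C f (unity_root N j *\<^sub>C x))"
  unfolding assms(3) hpoly_homogeneous[OF assms(1)]
  by (rule unity_root_average) (use assms in auto)

text \<open>Plays the part of Cauchy's estimate: a component is a weighted mean of values of
  \<open>f\<close> on the circle through \<open>x\<close>, so no constant depending on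
  \<open>d\<close> appears.\<close>

lemma component_bound:
  assumes "\<And>k. hpoly k (P k)" "\<And>k x. k > d \<Longrightarrow> P k x = 0" "\<And>x. f x = (\<Sum>k\<le>d. P k x)"
    and M: "\<And>c. cmod c = 1 \<Longrightarrow> norm (f (c *\<^sub>C x)) \<le> M"
  shows "norm (P k x) \<le> M"
proof -
  \<comment> \<open>Both \<open>d\<close> and \<open>k\<close> must lie below the number of
    roots.\<close>
  define N where "N = Suc (max d k)"
  have "norm (P k x) \<le> (\<Sum>j<N. norm ((inverse (unity_root N j) ^ k / of_nat N) *\<^sub>C f (unity_root N j *\<^sub>C x)))"
    using component_average[OF assms(1-3), of N k x] by (simp add: norm_sum N_def del: sum.lessThan_Suc)
  also have "\<dots> \<le> (\<Sum>j<N. 1 / of_nat N * M)"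
    using M by (intro sum_mono)
      (auto simp: norm_scaleC norm_divide norm_power norm_inverse divide_right_mono)
  also have "\<dots> = M" by (simp add: N_def del: of_nat_Suc sum.lessThan_Suc)
  finally show ?thesis .
qed

text \<open>Averaging \<open>f\<close> with the weights of degree \<open>k\<close> returns
  \<open>f\<close> itself, so \<open>f\<close> coincides with its component of that degree.\<close>

lemma homogeneous_polymap_imp_hpoly:
  assumes "polymap f" "\<And>c x. f (c *\<^sub>C x) = c ^ k *\<^sub>C f x"
  shows "hpoly k f"
proof -
  obtain d P where P: "\<And>k. hpoly k (P k)" "\<And>k x. k > d \<Longrightarrow> P k x = 0" "\<And>x. f x = (\<Sum>k\<le>d. P k x)"
    using polymap_components[OF assms(1)] by blast
  define N where "N = Suc (max d k)"
  have "P k x = f x" for x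
  proof -
    have "P k x = (\<Sum>j<N. (inverse (unity_root N j) ^ k / of_nat N) *\<^sub>C f (unity_root N j *\<^sub>C x))"
      by (rule component_average[OF P]) (auto simp: N_def)
    also have "\<dots> = (\<Sum>j<N. (1 / of_nat N) *\<^sub>C f x)"
      by (simp add: assms(2) scaleC_scaleC power_mult_distrib[symmetric])
    also have "\<dots> = f x"
      by (simp add: complex_vector.scale_sum_left[symmetric] N_def scaleC_one del: of_nat_Suc)
    finally show ?thesis .
  qed
  then show ?thesis using P(1)[of k] by (simp add: ext[of "P k" f])
qed

text \<open>Tensor-product interpolation at roots of unity: a homogeneous polynomial depends linearly
  on finitely many of its values, so pointwise limits stay within the space.\<close>

lemma hpoly_interpolation:
  assumes "hpoly k f"
  shows "f x = (\<Sum>g\<in>PiE {1..n} (\<lambda>_. {..<Suc k}).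
    (\<Prod>i=1..n. interpolant (Suc k) (g i) (\<phi> i x)) *\<^sub>C f (\<Sum>i=1..n. unity_root (Suc k) (g i) *\<^sub>C e i))"
  using assms
proof (induction rule: hpoly.induct)
  case (hpoly_monomial xs k c)
  \<comment> \<open>A monomial of degree \<open>k\<close> has exponents at most \<open>k\<close>, so
    \<open>k + 1\<close> nodes per coordinate suffice.\<close>
  let ?N = "Suc k"
  have mono: "monomial xs y = (\<Prod>i=1..n. \<phi> i y ^ count_list xs i)" for y
    unfolding monomial_def using hpoly_monomial by (intro prod_list_map_eq_prod_count) auto
  have node: "monomial xs (\<Sum>i=1..n. c i *\<^sub>C e i) = (\<Prod>i=1..n. c i ^ count_list xs i)" for c
    unfolding mono by (intro prod.cong refl) (simp only: phi_coords)
  have count: "count_list xs i < ?N" for i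
    using count_le_length[of xs i] hpoly_monomial by simp
  have "monomial xs x = (\<Prod>i=1..n. \<Sum>j<?N. unity_root ?N j ^ count_list xs i * interpolant ?N j (\<phi> i x))"
    unfolding mono using interpolant_reproduces_power[OF count] by simp
  also have "\<dots> = (\<Sum>g\<in>PiE {1..n} (\<lambda>_. {..<?N}).
      \<Prod>i=1..n. unity_root ?N (g i) ^ count_list xs i * interpolant ?N (g i) (\<phi> i x))"
    by (rule prod_sum_PiE) auto
  also have "\<dots> = (\<Sum>g\<in>PiE {1..n} (\<lambda>_. {..<?N}). (\<Prod>i=1..n. interpolant ?N (g i) (\<phi> i x)) *
      monomial xs (\<Sum>i=1..n. unity_root ?N (g i) *\<^sub>C e i))"
    unfolding node by (simp add: prod.distrib mult.commute)
  finally show ?case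
    by (simp add: complex_vector.scale_sum_left scaleC_scaleC)
qed (simp_all add: scaleC_add_right sum.distrib)

text \<open>The interpolation formula passes to the limit, but its coefficients have degree up to
  \<open>k\<close> in each coordinate, so it only shows that \<open>f\<close> is polynomial; the
  exact degree comes from homogeneity, which also survives the limit.\<close>

lemma hpoly_pointwise_limit:
  assumes "\<And>j. hpoly k (fs j)" "\<And>x. (\<lambda>j. fs j x) \<longlonglongrightarrow> f x"
  shows "hpoly k f"
proof (rule homogeneous_polymap_imp_hpoly)
  define L where "L g x = (\<Prod>i=1..n. interpolant (Suc k) (g i) (\<phi> i x))" for g x
  define F where "F h x = (\<Sum>g\<in>PiE {1..n} (\<lambda>_. {..<Suc k}).
    L g x *\<^sub>C h (\<Sum>i=1..n. unity_root (Suc k) (g i) *\<^sub>C e i))" for h :: "'a \<Rightarrow> 'b" and x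
  have "F (fs j) x = fs j x" for j x
    unfolding F_def L_def by (rule hpoly_interpolation[OF assms(1), symmetric])
  moreover have "(\<lambda>j. F (fs j) x) \<longlonglongrightarrow> F f x" for x
    unfolding F_def by (intro tendsto_intros assms)
  ultimately have *: "f = F f"
    using LIMSEQ_unique[OF assms(2)] by (intro ext) simp
  have "polymap (\<lambda>x. interpolant N j (\<phi> i x))" if "i \<in> {1..n}" for N j i
    unfolding interpolant_def
  proof (rule polymap_sum)
    fix a
    show "polymap (\<lambda>x. \<phi> i x ^ a * inverse (unity_root N j) ^ a / of_nat N)"
      using polymap_cscale[OF polymap_power[OF polymap_phi[OF that]],
          of "inverse (unity_root N j) ^ a / of_nat N" a]
      by (simp add: scaleC_complex_def mult_ac)
  qed
  then have "polymap (L g)" for g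
    unfolding L_def by (rule polymap_prod)
  then have "polymap (F f)"
    unfolding F_def by (intro polymap_sum polymap_mult polymap_const)
  then show "polymap f" by (subst *)
next
  fix c x
  have "(\<lambda>j. c ^ k *\<^sub>C fs j x) \<longlonglongrightarrow> c ^ k *\<^sub>C f x"
    by (intro tendsto_intros assms)
  then have "(\<lambda>j. fs j (c *\<^sub>C x)) \<longlonglongrightarrow> c ^ k *\<^sub>C f x"
    by (simp only: hpoly_homogeneous[OF assms(1)])
  then show "f (c *\<^sub>C x) = c ^ k *\<^sub>C f x"
    by (rule LIMSEQ_unique[OF assms(2)])
qed

section \<open>Uniform limits of polynomial maps\<close>

definition poly_limit :: "real \<Rightarrow> ('a \<Rightarrow> 'b::complex_normed_vector) \<Rightarrow> bool"
  where "poly_limit r f \<longleftrightarrow> (\<forall>\<epsilon>>0. \<exists>p. polymap p \<and> (\<forall>x\<in>ball 0 r. norm (f x - p x) < \<epsilon>))"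

lemma polymap_imp_poly_limit: "polymap p \<Longrightarrow> poly_limit r p"
  unfolding poly_limit_def by (intro allI impI exI[of _ p]) simp

lemma poly_limit_mono: "poly_limit r f \<Longrightarrow> s \<le> r \<Longrightarrow> poly_limit s f"
  unfolding poly_limit_def by (meson ball_subset_ball_iff subset_ball subsetD)

lemma poly_limit_cong: "poly_limit r f \<Longrightarrow> (\<And>x. x \<in> ball 0 r \<Longrightarrow> f x = g x) \<Longrightarrow> poly_limit r g"
  unfolding poly_limit_def by simp

lemma poly_limit_add:
  assumes "poly_limit r f" "poly_limit r g" shows "poly_limit r (\<lambda>x. f x + g x)"
  unfolding poly_limit_def
proof (intro allI impI)
  fix \<epsilon> :: real assume "\<epsilon> > 0"
  then have "\<epsilon> / 2 > 0" by simp
  then obtain p q where p: "polymap p" "\<forall>x\<in>ball 0 r. norm (f x - p x) < \<epsilon> / 2"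
    and q: "polymap q" "\<forall>x\<in>ball 0 r. norm (g x - q x) < \<epsilon> / 2"
    using assms unfolding poly_limit_def by meson
  have "norm (f x + g x - (p x + q x)) < \<epsilon>" if "x \<in> ball 0 r" for x
    using p(2) q(2) that by (auto intro: norm_diff_triangle_ineq[THEN le_less_trans] dest!: bspec)
  then show "\<exists>p. polymap p \<and> (\<forall>x\<in>ball 0 r. norm (f x + g x - p x) < \<epsilon>)"
    using polymap_add[OF p(1) q(1)] by blast
qed

text \<open>The gap between \<open>r'\<close> and \<open>r\<close> leaves room for a polynomial
  close to \<open>g\<close>: it may leave the image of \<open>g\<close>, yet has to stay where the
  approximant of \<open>f\<close> is Lipschitz.\<close>

lemma poly_limit_compose:
  assumes f: "poly_limit r f" and g: "poly_limit s g" and "r' < r"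
    and gr: "\<And>x. x \<in> ball 0 s \<Longrightarrow> norm (g x) \<le> r'"
  shows "poly_limit s (\<lambda>x. f (g x))"
  unfolding poly_limit_def
proof (intro allI impI)
  fix \<epsilon> :: real assume \<epsilon>: "\<epsilon> > 0"
  then obtain p where p: "polymap p" "\<And>x. x \<in> ball 0 r \<Longrightarrow> norm (f x - p x) < \<epsilon> / 2"
    using f unfolding poly_limit_def by (meson half_gt_zero)
  obtain L where L: "L-lipschitz_on (cball 0 r) p"
    using polymap_lipschitz[OF p(1)] by blast
  then have L0: "L \<ge> 0" by (rule lipschitz_on_nonneg)
  \<comment> \<open>The first entry keeps \<open>q x\<close> within radius \<open>r\<close>; the
    second holds the error after applying \<open>p\<close> to at most \<open>\<epsilon> / 2\<close>,
    the 1 guarding against \<open>L = 0\<close>.\<close>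
  define \<eta> where "\<eta> = min (r - r') (\<epsilon> / (2 * (L + 1)))"
  have \<eta>: "\<eta> > 0" "\<eta> \<le> r - r'" "\<eta> \<le> \<epsilon> / (2 * (L + 1))"
    using \<epsilon> L0 assms(3) by (auto simp: \<eta>_def)
  then obtain q where q: "polymap q" "\<And>x. x \<in> ball 0 s \<Longrightarrow> norm (g x - q x) < \<eta>"
    using g unfolding poly_limit_def by meson
  have "norm (f (g x) - p (q x)) < \<epsilon>" if x: "x \<in> ball 0 s" for x
  proof -
    have gx: "norm (g x) < r" using gr[OF x] assms(3) by simp
    have qx: "norm (q x) \<le> r"
      using q(2)[OF x] gr[OF x] \<eta>(2) norm_triangle_sub[of "q x" "g x"] by (simp add: norm_minus_commute)
    have "norm (p (g x) - p (q x)) \<le> L * norm (g x - q x)"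
      using lipschitz_onD[OF L, of "g x" "q x"] gx qx by (simp add: dist_norm)
    also have "\<dots> \<le> L * (\<epsilon> / (2 * (L + 1)))"
      using q(2)[OF x] \<eta>(3) L0 by (intro mult_left_mono) auto
    also have "\<dots> \<le> \<epsilon> / 2" using L0 \<epsilon> by (simp add: field_simps)
    finally have "norm (p (g x) - p (q x)) \<le> \<epsilon> / 2" .
    moreover have "norm (f (g x) - p (g x)) < \<epsilon> / 2" using p(2) gx by simp
    ultimately show ?thesis
      using norm_triangle_ineq[of "f (g x) - p (g x)" "p (g x) - p (q x)"] by simp
  qed
  then show "\<exists>p. polymap p \<and> (\<forall>x\<in>ball 0 s. norm (f (g x) - p x) < \<epsilon>)"
    using polymap_compose[OF p(1) q(1)] by blast
qed

lemma hpoly_real_scale: "hpoly k f \<Longrightarrow> f (t *\<^sub>R x) = t ^ k *\<^sub>R f x"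
  by (simp add: scaleR_scaleC hpoly_homogeneous)

text \<open>Uniform closeness of polynomials passes to their homogeneous components, with a bound
  independent of the degree; shrinking the ball by 2 makes the errors geometrically summable.\<close>

lemma poly_limit_imp_power_series:
  fixes f :: "'a \<Rightarrow> 'b::{complex_normed_vector, banach}"
  assumes f: "poly_limit r f" and r: "r > 0"
  shows "has_power_series_at_0 f"
proof -
  define \<delta> where "\<delta> j = inverse (real (Suc j))" for j
  have \<delta>0: "\<delta> j > 0" for j by (simp add: \<delta>_def)
  have \<delta>lim: "\<delta> \<longlonglongrightarrow> 0" unfolding \<delta>_def by (rule LIMSEQ_inverse_real_of_nat)
  have "\<forall>j. \<exists>p. polymap p \<and> (\<forall>x\<in>ball 0 r. norm (f x - p x) < \<delta> j)"
    using f \<delta>0 unfolding poly_limit_def by blast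
  then obtain p where p: "\<And>j. polymap (p j)" "\<And>j x. x \<in> ball 0 r \<Longrightarrow> norm (f x - p j x) < \<delta> j"
    by metis
  have "\<forall>j. \<exists>d P. (\<forall>k. hpoly k (P k)) \<and> (\<forall>k>d. \<forall>x. P k x = 0) \<and> (\<forall>x. p j x = (\<Sum>k\<le>d. P k x))"
    using polymap_components[OF p(1)] by blast
  then obtain d P where P: "\<And>j k. hpoly k (P j k)" "\<And>j k x. k > d j \<Longrightarrow> P j k x = 0"
    "\<And>j x. p j x = (\<Sum>k\<le>d j. P j k x)"
    by metis
  have bound: "norm (P i k x - P j k x) \<le> \<delta> i + \<delta> j" if x: "x \<in> ball 0 r" for i j k x
  proof -
    define D where "D = max (d i) (d j)"
    have eq: "p i x = (\<Sum>k\<le>D. P i k x)" "p j x = (\<Sum>k\<le>D. P j k x)" for x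
      unfolding P(3) D_def by (rule sum.mono_neutral_left; use P(2) in auto)+
    have neg: "hpoly k (\<lambda>x. - P j k x)" for k
      using homogeneous_polymap_imp_hpoly[OF polymap_cscale[OF hpoly_imp_polymap[OF P(1)], of "-1" j k], of k]
      by (simp add: hpoly_homogeneous[OF P(1)] scaleC_one)
    show ?thesis
    proof (rule component_bound[where f = "\<lambda>x. p i x - p j x" and d = D and P = "\<lambda>k x. P i k x - P j k x"])
      show "hpoly k (\<lambda>x. P i k x - P j k x)" for k
        using hpoly_add[OF P(1)[of k i] neg] by simp
      show "P i k x - P j k x = 0" if "k > D" for k x
        using that P(2) by (simp add: D_def)
      show "p i x - p j x = (\<Sum>k\<le>D. P i k x - P j k x)" for x
        by (simp add: eq sum_subtractf)
      fix c :: complex assume "cmod c = 1"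
      then have "c *\<^sub>C x \<in> ball 0 r" using x by (simp add: norm_scaleC)
      from p(2)[OF this, of i] p(2)[OF this, of j]
      show "norm (p i (c *\<^sub>C x) - p j (c *\<^sub>C x)) \<le> \<delta> i + \<delta> j"
        using norm_triangle_ineq4[of "f (c *\<^sub>C x) - p j (c *\<^sub>C x)" "f (c *\<^sub>C x) - p i (c *\<^sub>C x)"] by simp
    qed
  qed
  \<comment> \<open>\<open>bound\<close> makes the sequence Cauchy in the ball only; scaling by
    \<open>t\<close> reaches all points, as \<open>hpoly_pointwise_limit\<close> demands.\<close>
  have "convergent (\<lambda>j. P j k x)" for k x
  proof -
    obtain t where t: "t > 0" and tx: "t *\<^sub>R x \<in> ball 0 r"
      using ball_absorbing[OF r] .
    have "Cauchy (\<lambda>j. P j k (t *\<^sub>R x))"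
    proof (rule metric_CauchyI)
      fix \<epsilon> :: real assume "\<epsilon> > 0"
      then obtain N where N: "\<And>j. j \<ge> N \<Longrightarrow> \<delta> j < \<epsilon> / 2"
        using order_tendstoD(2)[OF \<delta>lim, of "\<epsilon> / 2"] by (auto simp: eventually_sequentially)
      show "\<exists>N. \<forall>i\<ge>N. \<forall>j\<ge>N. dist (P i k (t *\<^sub>R x)) (P j k (t *\<^sub>R x)) < \<epsilon>"
      proof (intro exI[of _ N] allI impI)
        fix i j assume "i \<ge> N" "j \<ge> N"
        then show "dist (P i k (t *\<^sub>R x)) (P j k (t *\<^sub>R x)) < \<epsilon>"
          using bound[OF tx, of i k j] N[of i] N[of j] by (simp add: dist_norm)
      qed
    qed
    then obtain l where "(\<lambda>j. P j k (t *\<^sub>R x)) \<longlonglongrightarrow> l"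
      using Cauchy_convergent convergent_def by blast
    from tendsto_scaleR[OF tendsto_const[of "inverse (t ^ k)"] this]
    have "(\<lambda>j. P j k x) \<longlonglongrightarrow> inverse (t ^ k) *\<^sub>R l"
      using t by (simp add: hpoly_real_scale[OF P(1)])
    then show ?thesis by (rule convergentI)
  qed
  then obtain G where G: "\<And>k x. (\<lambda>j. P j k x) \<longlonglongrightarrow> G k x"
    unfolding convergent_def by metis
  have hG: "hpoly k (G k)" for k
    by (rule hpoly_pointwise_limit[OF P(1) G])
  have bG: "norm (G k x - P j k x) \<le> \<delta> j" if "x \<in> ball 0 r" for j k x
  proof (rule LIMSEQ_le)
    show "(\<lambda>i. norm (P i k x - P j k x)) \<longlonglongrightarrow> norm (G k x - P j k x)"
      by (intro tendsto_intros G)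
    show "(\<lambda>i. \<delta> i + \<delta> j) \<longlonglongrightarrow> \<delta> j"
      using tendsto_add[OF \<delta>lim tendsto_const[of "\<delta> j"]] by simp
  qed (use bound that in blast)
  have "(\<lambda>k. G k x) sums f x" if x: "x \<in> ball 0 (r / 2)" for x
  proof -
    have x2: "2 *\<^sub>R x \<in> ball 0 r" using x by simp
    have small: "norm (G k x - P j k x) \<le> \<delta> j * (1 / 2) ^ k" for j k
    proof -
      have "norm (G k (2 *\<^sub>R x) - P j k (2 *\<^sub>R x)) = 2 ^ k * norm (G k x - P j k x)"
        by (simp add: hpoly_real_scale[OF hG] hpoly_real_scale[OF P(1)] flip: scaleR_diff_right)
      then show ?thesis using bG[OF x2, of k j] by (simp add: field_simps)
    qed
    have geo: "(\<lambda>k. \<delta> j * (1 / 2) ^ k) sums (\<delta> j * 2)" for j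
      using sums_mult[OF geometric_sums[of "1/2 :: real"], of "\<delta> j"] by simp
    have summ: "summable (\<lambda>k. norm (G k x - P j k x))" for j
      using small by (intro summable_comparison_test'[OF sums_summable[OF geo[of j]]]) simp
    have Psums: "(\<lambda>k. P j k x) sums p j x" for j
      unfolding P(3) by (rule sums_finite) (use P(2) in auto)
    \<comment> \<open>The difference to any fixed approximant is summable, and the approximant's own
      series is finite; index 0 is an arbitrary choice.\<close>
    have "summable (\<lambda>k. (G k x - P 0 k x) + P 0 k x)"
      by (intro summable_add summable_norm_cancel[OF summ] sums_summable[OF Psums])
    then have Gsum: "summable (\<lambda>k. G k x)" by simp
    \<comment> \<open>Of the factor 3, the geometric sum of the component errors contributes 2 and
      the distance from \<open>f\<close> to \<open>p j\<close> contributes 1.\<close>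
    have "norm ((\<Sum>k. G k x) - f x) \<le> \<delta> j * 3" for j
    proof -
      have "(\<Sum>k. G k x) - p j x = (\<Sum>k. G k x - P j k x)"
        using suminf_diff[OF Gsum sums_summable[OF Psums[of j]]] sums_unique[OF Psums[of j]] by simp
      also have "norm \<dots> \<le> (\<Sum>k. norm (G k x - P j k x))"
        by (rule summable_norm[OF summ])
      also have "\<dots> \<le> (\<Sum>k. \<delta> j * (1 / 2) ^ k)"
        by (intro suminf_le small summ sums_summable[OF geo])
      also have "\<dots> = \<delta> j * 2" using geo by (simp add: sums_iff)
      finally have "norm ((\<Sum>k. G k x) - p j x) \<le> \<delta> j * 2" .
      moreover have "norm (f x - p j x) < \<delta> j" using p(2)[of x j] x r by simp
      ultimately show ?thesis
        using norm_triangle_ineq4[of "(\<Sum>k. G k x) - p j x" "f x - p j x"] by simp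
    qed
    moreover have "(\<lambda>j. \<delta> j * 3) \<longlonglongrightarrow> 0"
      using tendsto_mult_left[OF \<delta>lim, of 3] by (simp add: mult.commute)
    ultimately have "norm ((\<Sum>k. G k x) - f x) \<le> 0"
      using LIMSEQ_le_const[of "\<lambda>j. \<delta> j * 3" 0] by blast
    then show ?thesis using Gsum by (simp add: sums_iff)
  qed
  moreover have "\<forall>\<^sub>F x in nhds (0::'a). x \<in> ball 0 (r / 2)"
    using r by (intro eventually_nhds_in_open) auto
  ultimately show ?thesis
    unfolding has_power_series_at_0_def
    by (intro exI[of _ G] conjI allI hpoly_imp_hom_polys hG) (auto elim: eventually_mono)
qed

section \<open>Geometric bounds for the terms of a power series\<close>

lemma hpoly_at_0: "hpoly k f \<Longrightarrow> k > 0 \<Longrightarrow> f 0 = 0"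
  using hpoly_homogeneous[of k f 0 0] by (simp add: power_0_left)

text \<open>Composing with \<open>z \<mapsto> (\<phi> i z / \<phi> i a) a + y\<close> makes \<open>f y\<close> the degree-0 component, at the
  point \<open>a\<close>, of a polynomial map, where the averaging bound applies.\<close>

lemma polymap_max_modulus:
  assumes f: "polymap f" and M: "\<And>c. cmod c = 1 \<Longrightarrow> norm (f (c *\<^sub>C a + y)) \<le> M"
  shows "norm (f y) \<le> M"
proof (cases "a = 0")
  case True
  then show ?thesis using M[of 1] by simp
next
  case False
  then obtain i where i: "i \<in> {1..n}" "\<phi> i a \<noteq> 0"
    using expand[of a] by (metis (no_types, lifting) complex_vector.scale_zero_left sum.neutral)
  define g where "g z = f ((\<phi> i z / \<phi> i a) *\<^sub>C a + y)" for z
  have "polymap (\<lambda>z. (\<phi> i z) *\<^sub>C ((1 / \<phi> i a) *\<^sub>C a) + y)"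
    using i by (intro polymap_add polymap_mult_phi polymap_const)
  then have "polymap g"
    using polymap_compose[OF f] unfolding g_def by (simp add: scaleC_scaleC)
  from polymap_components[OF this] obtain d P
    where P: "\<And>k. hpoly k (P k)" "\<And>k x. k > d \<Longrightarrow> P k x = 0" "\<And>x. g x = (\<Sum>k\<le>d. P k x)"
    by blast
  have "f y = g 0" using bounded_linear_phi[OF i(1)] by (simp add: g_def bounded_linear.linear linear_0)
  also have "\<dots> = (\<Sum>k\<le>d. if k = 0 then P 0 0 else 0)"
    unfolding P(3) by (intro sum.cong) (auto simp: hpoly_at_0[OF P(1)])
  also have "\<dots> = P 0 a"
    using hpoly_homogeneous[OF P(1)[of 0], of 0 a] by (simp add: scaleC_one)
  finally have "f y = P 0 a" .
  moreover have "norm (P 0 a) \<le> M"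
  proof (rule component_bound[OF P])
    fix c assume "cmod c = 1"
    then show "norm (g (c *\<^sub>C a)) \<le> M"
      using M[of c] i by (simp add: g_def phi_scale)
  qed
  ultimately show ?thesis by simp
qed

lemma hpoly_continuous: "hpoly k f \<Longrightarrow> continuous_on S f"
  using hpoly_imp_hom_polys[of k f] by (auto simp: hom_polys_def intro: continuous_on_subset)

text \<open>Baire's theorem turns pointwise into uniform bounds on some ball around a point \<open>a\<close>; the maximum
  principle moves that ball to the origin.\<close>

lemma hpoly_geometric_bound:
  fixes P :: "nat \<Rightarrow> 'a \<Rightarrow> 'b::complex_normed_vector"
  assumes P: "\<And>k. hpoly k (P k)" and r: "r > 0"
    and bdd: "\<And>x. x \<in> ball 0 r \<Longrightarrow> Bseq (\<lambda>k. P k x)"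
  obtains C B where "C \<ge> 0" "B \<ge> 0" "\<And>k x. norm (P k x) \<le> C * (B * norm x) ^ k"
proof -
  \<comment> \<open>The exponent exceeds the degree by one: \<open>M\<close> serves both as constant
    and as rate, so one natural number indexes the closed sets.\<close>
  define E where "E M = {x. \<forall>k. norm (P k x) \<le> real M ^ Suc k}" for M :: nat
  have "E M = (\<Inter>k. {x. norm (P k x) \<le> real M ^ Suc k})" for M
    by (auto simp: E_def)
  then have closed: "closed (E M)" for M
    by (auto intro!: closed_Collect_le continuous_intros hpoly_continuous[OF P])
  have "x \<in> (\<Union>M. E M)" for x
  proof -
    obtain t where t: "t > 0" and tx: "t *\<^sub>R x \<in> ball 0 r"
      using ball_absorbing[OF r] .
    from tx obtain K where K: "\<And>k. norm (P k (t *\<^sub>R x)) \<le> K"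
      using bdd BseqE by blast
    obtain M :: nat where M: "max K (1 / t) \<le> M" using real_arch_simple by blast
    have "norm (P k x) \<le> real M ^ Suc k" for k
    proof -
      have "norm (P k x) = (1 / t) ^ k * norm (P k (t *\<^sub>R x))"
        using t by (simp add: hpoly_real_scale[OF P] power_divide)
      also have "\<dots> \<le> real M ^ k * real M"
        using t M K[of k] by (intro mult_mono power_mono) auto
      finally show ?thesis by (simp add: mult.commute)
    qed
    then show ?thesis by (auto simp: E_def)
  qed
  then have UN: "(\<Union>M. E M) = UNIV" by blast
  have "\<exists>M. interior (E M) \<noteq> {}"
  proof (rule ccontr)
    assume "\<nexists>M. interior (E M) \<noteq> {}"
    then have "euclidean interior_of \<Union> (range E) = {}"
      using closed completely_metrizable_space_euclidean by (intro Baire_category_alt) auto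
    then show False using UN by simp
  qed
  then obtain M a where "a \<in> interior (E M)" by blast
  then obtain \<rho> where \<rho>: "\<rho> > 0" "ball a \<rho> \<subseteq> E M" by (meson mem_interior)
  have near: "norm (P k y) \<le> real M ^ Suc k" if "norm y < \<rho>" for k y
  proof (rule polymap_max_modulus[OF hpoly_imp_polymap[OF P]])
    fix c :: complex assume c: "cmod c = 1"
    then have "c \<noteq> 0" by auto
    \<comment> \<open>Pulling out \<open>c\<close> costs a factor of modulus 1 and leaves a point of
      the ball around \<open>a\<close>.\<close>
    then have "c *\<^sub>C a + y = c *\<^sub>C (a + inverse c *\<^sub>C y)"
      by (simp add: scaleC_add_right scaleC_scaleC scaleC_one)
    moreover have "a + inverse c *\<^sub>C y \<in> E M"
      using \<rho>(2) that c by (auto simp: dist_norm norm_scaleC norm_inverse intro!: subsetD[OF \<rho>(2)])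
    ultimately show "norm (P k (c *\<^sub>C a + y)) \<le> real M ^ Suc k"
      using c by (simp add: hpoly_homogeneous[OF P] norm_scaleC norm_power E_def)
  qed
  have "norm (P k x) \<le> real M * (2 * M / \<rho> * norm x) ^ k" for k x
  proof (cases "x = 0")
    case True
    then show ?thesis
      using near[of 0 k] hpoly_at_0[OF P, of k] \<rho>(1) by (cases "k = 0") auto
  next
    case False
    \<comment> \<open>\<open>t\<close> brings \<open>x\<close> to norm \<open>\<rho> / 2\<close>,
      where \<open>near\<close> applies.\<close>
    define t where "t = \<rho> / (2 * norm x)"
    have t: "t > 0" "norm (t *\<^sub>R x) < \<rho>" using \<rho>(1) False by (auto simp: t_def)
    have "norm (P k x) = (1 / t) ^ k * norm (P k (t *\<^sub>R x))"
      using t(1) by (simp add: hpoly_real_scale[OF P] power_divide)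
    also have "\<dots> \<le> (1 / t) ^ k * real M ^ Suc k"
      using t by (intro mult_left_mono near) auto
    also have "\<dots> = real M * (2 * M / \<rho> * norm x) ^ k"
      using \<rho>(1) False by (simp add: t_def field_simps)
    finally show ?thesis .
  qed
  then show ?thesis using that[of "real M" "2 * M / \<rho>"] \<rho>(1) by simp
qed

text \<open>Terms of a convergent series are bounded at each point, so
  \<open>hpoly_geometric_bound\<close> applies and tails are dominated by geometric series; the
  constants serve all \<open>N\<close> at once.\<close>

lemma power_series_tail:
  fixes f :: "'a \<Rightarrow> 'b::{complex_normed_vector, banach}"
  assumes "has_power_series_at_0 f"
  obtains P C B r where "\<And>k. hpoly k (P k)" "r > 0" "r < 1" "C \<ge> 0" "B \<ge> 0"
    "\<And>x :: 'a. x \<in> ball 0 r \<Longrightarrow> B * norm x \<le> 1 / 2"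
    "\<And>N x. x \<in> ball 0 r \<Longrightarrow> norm (f x - (\<Sum>k<N. P k x)) \<le> C * (B * norm x) ^ N"
proof -
  obtain P where P: "\<And>k. P k \<in> hom_polys k" "\<forall>\<^sub>F x in nhds 0. (\<lambda>k. P k x) sums f x"
    using assms by (auto simp: has_power_series_at_0_def)
  have hP: "hpoly k (P k)" for k by (rule hom_polys_imp_hpoly[OF P(1)])
  obtain s where s: "s > 0" "\<And>x. x \<in> ball 0 s \<Longrightarrow> (\<lambda>k. P k x) sums f x"
    using P(2) by (auto simp: eventually_nhds_metric dist_commute)
  have "Bseq (\<lambda>k. P k x)" if "x \<in> ball 0 s" for x
    using s(2)[OF that] by (meson convergent_imp_Bseq convergentI summable_LIMSEQ_zero sums_summable)
  then obtain C B where CB: "C \<ge> 0" "B \<ge> 0" "\<And>k x. norm (P k x) \<le> C * (B * norm x) ^ k"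
    using hpoly_geometric_bound[where P = P, OF hP s(1)] by blast
  \<comment> \<open>\<open>s\<close> secures convergence, the last entry makes the ratio
    \<open>B * norm x\<close> at most 1/2, and the first gives \<open>r < 1\<close>, by which powers
    of \<open>norm x\<close> are compared later.\<close>
  define r where "r = min (1 / 2) (min s (1 / (2 * (B + 1))))"
  have r: "r > 0" "r < 1" "r \<le> s" "r \<le> 1 / (2 * (B + 1))" using s CB by (auto simp: r_def)
  have half: "B * norm x \<le> 1 / 2" if "x \<in> ball 0 r" for x :: 'a
  proof -
    have "B * norm x \<le> B * (1 / (2 * (B + 1)))"
      using that r(4) CB(2) by (intro mult_left_mono) auto
    also have "\<dots> \<le> 1 / 2" using CB(2) by (simp add: field_simps)
    finally show ?thesis .
  qed
  \<comment> \<open>The factor 2 bounds \<open>1 / (1 - q)\<close> for ratios \<open>q\<close> up to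
    1/2.\<close>
  have "norm (f x - (\<Sum>k<N. P k x)) \<le> (2 * C) * (B * norm x) ^ N" if x: "x \<in> ball 0 r" for x N
  proof -
    define q where "q = B * norm x"
    have q: "0 \<le> q" "q \<le> 1 / 2" using half[OF x] CB(2) by (auto simp: q_def)
    have geo: "(\<lambda>k. C * q ^ N * q ^ k) sums (C * q ^ N * (1 / (1 - q)))"
      using q by (intro sums_mult geometric_sums) simp
    have le: "norm (P (k + N) x) \<le> C * q ^ N * q ^ k" for k
      using CB(3)[of "k + N" x] by (simp add: q_def power_add mult_ac)
    have summ: "summable (\<lambda>k. norm (P (k + N) x))"
      using le by (intro summable_comparison_test'[OF sums_summable[OF geo]]) simp
    have "(\<lambda>k. P (k + N) x) sums (f x - (\<Sum>k<N. P k x))"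
      by (intro sums_split_initial_segment s(2)) (use x r(3) in simp)
    then have "norm (f x - (\<Sum>k<N. P k x)) = norm (\<Sum>k. P (k + N) x)"
      by (simp add: sums_iff)
    also have "\<dots> \<le> (\<Sum>k. norm (P (k + N) x))" by (rule summable_norm[OF summ])
    also have "\<dots> \<le> (\<Sum>k. C * q ^ N * q ^ k)"
      by (intro suminf_le le summ sums_summable[OF geo])
    also have "\<dots> = C * q ^ N * (1 / (1 - q))" using geo by (simp add: sums_iff)
    also have "\<dots> \<le> C * q ^ N * 2"
      using q CB(1) by (intro mult_left_mono) (auto simp: field_simps)
    finally show ?thesis by (simp add: q_def mult_ac)
  qed
  then show ?thesis using that[OF hP r(1,2), of "2 * C" B] CB half by simp
qed

lemma power_series_imp_poly_limit:
  fixes f :: "'a \<Rightarrow> 'b::{complex_normed_vector, banach}"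
  assumes "has_power_series_at_0 f"
  obtains r where "r > 0" "poly_limit r f"
proof -
  obtain P C B r where P: "\<And>k. hpoly k (P k)" and r: "r > 0" and C: "C \<ge> 0" "B \<ge> 0"
    and half: "\<And>x :: 'a. x \<in> ball 0 r \<Longrightarrow> B * norm x \<le> 1 / 2"
    and tail: "\<And>N x. x \<in> ball 0 r \<Longrightarrow> norm (f x - (\<Sum>k<N. P k x)) \<le> C * (B * norm x) ^ N"
    using power_series_tail[OF assms] by metis
  have "poly_limit r f"
    unfolding poly_limit_def
  proof (intro allI impI)
    fix \<epsilon> :: real assume \<epsilon>: "\<epsilon> > 0"
    have "(\<lambda>N. C * (1 / 2) ^ N) \<longlonglongrightarrow> 0"
      using tendsto_mult_left[OF LIMSEQ_power_zero[of "1/2 :: real"], of C] by simp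
    then obtain N where N: "C * (1 / 2) ^ N < \<epsilon>"
      using order_tendstoD(2)[OF _ \<epsilon>] by (metis eventually_sequentially order_refl)
    have "norm (f x - (\<Sum>k<N. P k x)) < \<epsilon>" if x: "x \<in> ball 0 r" for x
    proof -
      have "C * (B * norm x) ^ N \<le> C * (1 / 2) ^ N"
        using half[OF x] C by (intro mult_left_mono power_mono) auto
      then show ?thesis using tail[OF x, of N] N by linarith
    qed
    then show "\<exists>p. polymap p \<and> (\<forall>x\<in>ball 0 r. norm (f x - p x) < \<epsilon>)"
      by (intro exI[of _ "\<lambda>x. \<Sum>k<N. P k x"]) (auto intro: polymap_sum hpoly_imp_polymap P)
  qed
  then show ?thesis using that r by blast
qed

text \<open>At \<open>t *\<^sub>R x\<close> the value scales like \<open>t ^ k\<close> but its bound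
  like \<open>t ^ Suc k\<close>; divide and let \<open>t\<close> tend to 0 from the right.\<close>

lemma hpoly_zero_if_small:
  assumes f: "hpoly k f" and r: "r > 0"
    and le: "\<And>x. x \<in> ball 0 r \<Longrightarrow> norm (f x) \<le> K * norm x ^ Suc k"
  shows "f x = 0"
proof -
  have "norm (f x) \<le> t * (K * norm x ^ Suc k)" if t: "t > 0" "t * norm x < r" for t
  proof -
    have "t ^ k * norm (f x) \<le> t ^ k * (t * (K * norm x ^ Suc k))"
      using le[of "t *\<^sub>R x"] t by (simp add: hpoly_real_scale[OF f] power_mult_distrib mult_ac)
    then show ?thesis using t(1) by simp
  qed
  moreover have "((\<lambda>t. t * norm x) \<longlongrightarrow> 0 * norm x) (at_right 0)"
    by (intro tendsto_intros)
  then have "\<forall>\<^sub>F t in at_right 0. t * norm x < r"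
    using r by (intro order_tendstoD(2)[where a = r]) auto
  ultimately have "\<forall>\<^sub>F t in at_right 0. norm (f x) \<le> t * (K * norm x ^ Suc k)"
    by (auto elim: eventually_elim2 intro: eventually_at_right_less)
  moreover have "((\<lambda>t. t * (K * norm x ^ Suc k)) \<longlongrightarrow> 0 * (K * norm x ^ Suc k)) (at_right 0)"
    by (intro tendsto_intros)
  ultimately have "norm (f x) \<le> 0 * (K * norm x ^ Suc k)"
    by (intro tendsto_lowerbound) auto
  then show ?thesis by simp
qed

lemma power_series_leading_term:
  fixes f :: "'a \<Rightarrow> 'b::{complex_normed_vector, banach}"
  assumes "has_power_series_at_0 f"
    and O: "(\<lambda>x. norm (f x)) \<in> O[nhds 0](\<lambda>x. norm x ^ k)"
  obtains P C r where "hpoly k P" "r > 0" "C \<ge> 0"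
    "\<And>x. x \<in> ball 0 r \<Longrightarrow> norm (f x - P x) \<le> C * norm x ^ Suc k"
proof -
  obtain P C B r where P: "\<And>k. hpoly k (P k)" and r: "r > 0" "r < 1" and C: "C \<ge> 0" "B \<ge> 0"
    and tail: "\<And>N x. x \<in> ball 0 r \<Longrightarrow> norm (f x - (\<Sum>k<N. P k x)) \<le> C * (B * norm x) ^ N"
    using power_series_tail[OF assms(1)] by metis
  obtain K where K: "K > 0" "\<forall>\<^sub>F x in nhds 0. norm (f x) \<le> K * norm x ^ k"
    using landau_o.bigE[OF O] by (auto simp: norm_power)
  then obtain s where s: "s > 0" "\<And>x. x \<in> ball 0 s \<Longrightarrow> norm (f x) \<le> K * norm x ^ k"
    by (auto simp: eventually_nhds_metric dist_commute)
  have zero: "\<forall>x. P j x = 0" if "j < k" for j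
    using that
  proof (induction j rule: less_induct)
    case (less j)
    \<comment> \<open>With all lower terms gone, \<open>P j x\<close> is \<open>f x\<close> minus a
      remainder, and both are of order \<open>j + 1\<close> because \<open>j < k\<close>.\<close>
    have "norm (P j x) \<le> (C * B ^ Suc j + K) * norm x ^ Suc j" if x: "x \<in> ball 0 (min r s)" for x
    proof -
      have "(\<Sum>i<Suc j. P i x) = P j x" using less by simp
      then have "norm (f x - P j x) \<le> C * B ^ Suc j * norm x ^ Suc j"
        using tail[of x "Suc j"] x by (simp add: power_mult_distrib mult_ac)
      moreover have "norm x ^ k \<le> norm x ^ Suc j"
        using less.prems x r by (intro power_decreasing) auto
      then have "norm (f x) \<le> K * norm x ^ Suc j"
        using s(2)[of x] x K(1) by (meson min_less_iff_conj mem_ball mult_left_mono order_trans less_imp_le)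
      ultimately show ?thesis
        using norm_triangle_ineq4[of "f x" "f x - P j x"] by (simp add: algebra_simps)
    qed
    then show ?case
      using hpoly_zero_if_small[OF P, of "min r s"] r s by (metis min_less_iff_conj)
  qed
  have "norm (f x - P k x) \<le> C * B ^ Suc k * norm x ^ Suc k" if "x \<in> ball 0 r" for x
    using tail[OF that, of "Suc k"] zero by (simp add: power_mult_distrib mult_ac)
  then show ?thesis using that[OF P r(1), of "C * B ^ Suc k"] C by simp
qed

text \<open>Rescaling to the unit ball makes the Lipschitz constant a power of the radius; these
  powers yield both the contraction and the final order estimate.\<close>

lemma hpoly_lipschitz:
  assumes f: "hpoly (Suc k) f"
  obtains L where "L \<ge> 0"
    "\<And>M x y. norm x \<le> M \<Longrightarrow> norm y \<le> M \<Longrightarrow> norm (f x - f y) \<le> L * M ^ k * norm (x - y)"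
proof -
  obtain L where L: "L-lipschitz_on (cball 0 1) f"
    using polymap_lipschitz[OF hpoly_imp_polymap[OF f]] by blast
  have "norm (f x - f y) \<le> L * M ^ k * norm (x - y)" if M: "norm x \<le> M" "norm y \<le> M" for M x y
  proof (cases "M = 0")
    case True
    then show ?thesis using M by simp
  next
    case False
    then have M0: "M > 0" using M(1) norm_ge_zero[of x] by linarith
    have "norm (f x - f y) = M ^ Suc k * norm (f ((1 / M) *\<^sub>R x) - f ((1 / M) *\<^sub>R y))"
      using M0 by (simp add: hpoly_real_scale[OF f] power_divide flip: scaleR_diff_right)
    also have "norm (f ((1 / M) *\<^sub>R x) - f ((1 / M) *\<^sub>R y)) \<le> L * norm ((1 / M) *\<^sub>R x - (1 / M) *\<^sub>R y)"
      using lipschitz_onD[OF L, of "(1 / M) *\<^sub>R x" "(1 / M) *\<^sub>R y"] M M0 by (simp add: dist_norm)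
    also have "M ^ Suc k * (L * norm ((1 / M) *\<^sub>R x - (1 / M) *\<^sub>R y)) = L * M ^ k * norm (x - y)"
      using M0 by (simp flip: scaleR_diff_right)
    finally show ?thesis using M0 by simp
  qed
  then show ?thesis using that lipschitz_on_nonneg[OF L] by blast
qed

lemma clinear_imp_polymap:
  assumes "clinear D" shows "polymap D"
proof -
  have "D = (\<lambda>x. \<Sum>i=1..n. \<phi> i x *\<^sub>C D (e i))"
  proof
    fix x
    show "D x = (\<Sum>i=1..n. \<phi> i x *\<^sub>C D (e i))"
      using clinear_sum[OF assms, of "\<lambda>i. \<phi> i x *\<^sub>C e i" "{1..n}"] assms
      unfolding expand[of x, symmetric] by (simp add: clinear_iff)
  qed
  moreover have "polymap (\<lambda>x. \<Sum>i=1..n. \<phi> i x *\<^sub>C D (e i))"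
    by (intro polymap_sum polymap_mult_phi polymap_const)
  ultimately show ?thesis by simp
qed

section \<open>The normal form step\<close>

text \<open>For a monomial with coefficient \<open>c\<close> the equation becomes the linear system
  \<open>\<mu> *\<^sub>C v - D v = c\<close>, with \<open>\<mu>\<close> the product of the
  eigenvalues along \<open>xs\<close>; sums follow by linearity.\<close>

lemma homological_equation:
  fixes D :: "'a \<Rightarrow> 'a"
  assumes D: "clinear D" and eig: "\<And>i. i \<in> {1..n} \<Longrightarrow> D (e i) = lam i *\<^sub>C e i"
    and nonres: "\<And>j \<alpha>. j \<in> {1..n} \<Longrightarrow> (\<Sum>i=1..n. \<alpha> i) \<ge> 2 \<Longrightarrow> lam j \<noteq> (\<Prod>i=1..n. lam i ^ \<alpha> i)"
    and P: "hpoly k P" and k: "k \<ge> 2"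
  shows "\<exists>Q. hpoly k Q \<and> (\<forall>x. Q (D x) - D (Q x) = P x)"
  using P k
proof (induction rule: hpoly.induct)
  case (hpoly_zero k)
  have "D 0 = 0" using D by (metis clinear_iff complex_vector.scale_zero_left)
  then show ?case by (intro exI[of _ "\<lambda>_. 0"]) (simp add: hpoly.hpoly_zero)
next
  case (hpoly_monomial xs k c)
  define \<mu> where "\<mu> = prod_list (map lam xs)"
  have D_coords: "D x = (\<Sum>j=1..n. (\<phi> j x * lam j) *\<^sub>C e j)" for x
    using clinear_sum[OF D, of "\<lambda>i. \<phi> i x *\<^sub>C e i" "{1..n}"] D eig
    unfolding expand[of x, symmetric] by (simp add: clinear_iff scaleC_scaleC)
  have "\<phi> i (D x) = lam i * \<phi> i x" if "i \<in> {1..n}" for i x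
    unfolding D_coords by (simp only: phi_coords[OF that] mult.commute)
  then have mono: "monomial xs (D x) = \<mu> * monomial xs x" for x
    using hpoly_monomial(1) unfolding \<mu>_def by (induction xs) auto
  have \<mu>: "lam j \<noteq> \<mu>" if "j \<in> {1..n}" for j
  proof -
    have "\<mu> = (\<Prod>i=1..n. lam i ^ count_list xs i)"
      unfolding \<mu>_def using hpoly_monomial(1) by (intro prod_list_map_eq_prod_count) auto
    \<comment> \<open>The exponents add up to the degree, which is at least 2 as non-resonance
      requires.\<close>
    moreover have "(\<Sum>i=1..n. count_list xs i) = k"
      using hpoly_monomial by (simp add: sum_count_set)
    ultimately show ?thesis using nonres[OF that, of "count_list xs"] hpoly_monomial by simp
  qed
  \<comment> \<open>The system is diagonal in the basis \<open>e\<close>, and the denominators are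
    nonzero by non-resonance.\<close>
  define v where "v = (\<Sum>j=1..n. (\<phi> j c / (\<mu> - lam j)) *\<^sub>C e j)"
  have phi_v: "\<phi> j v = \<phi> j c / (\<mu> - lam j)" if "j \<in> {1..n}" for j
    unfolding v_def using that by (rule phi_coords)
  have "D v = (\<Sum>j=1..n. ((\<phi> j c / (\<mu> - lam j)) * lam j) *\<^sub>C e j)"
    unfolding D_coords[of v] by (intro sum.cong refl) (simp only: phi_v)
  then have "\<mu> *\<^sub>C v - D v = (\<Sum>j=1..n. (\<mu> * (\<phi> j c / (\<mu> - lam j))) *\<^sub>C e j - ((\<phi> j c / (\<mu> - lam j)) * lam j) *\<^sub>C e j)"
    by (simp add: v_def complex_vector.scale_sum_right scaleC_scaleC sum_subtractf)
  also have "\<dots> = (\<Sum>j=1..n. \<phi> j c *\<^sub>C e j)"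
  proof (intro sum.cong refl)
    fix j assume "j \<in> {1..n}"
    then have "\<mu> - lam j \<noteq> 0" using \<mu> by force
    moreover have "\<mu> * (\<phi> j c / (\<mu> - lam j)) - (\<phi> j c / (\<mu> - lam j)) * lam j
        = (\<mu> - lam j) * (\<phi> j c / (\<mu> - lam j))"
      by (simp only: left_diff_distrib mult.commute[of "\<phi> j c / (\<mu> - lam j)"])
    ultimately show "(\<mu> * (\<phi> j c / (\<mu> - lam j))) *\<^sub>C e j - ((\<phi> j c / (\<mu> - lam j)) * lam j) *\<^sub>C e j
        = \<phi> j c *\<^sub>C e j"
      unfolding complex_vector.scale_left_diff_distrib[symmetric] by simp
  qed
  also have "\<dots> = c"
    using expand[of c] by (rule sym)
  finally have v: "\<mu> *\<^sub>C v - D v = c" .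
  have "D (monomial xs x *\<^sub>C v) = monomial xs x *\<^sub>C D v" for x
    using D by (simp add: clinear_iff)
  then have "monomial xs (D x) *\<^sub>C v - D (monomial xs x *\<^sub>C v) = monomial xs x *\<^sub>C c" for x
    unfolding v[symmetric] mono
    by (simp add: scaleC_scaleC complex_vector.scale_right_diff_distrib mult.commute)
  then show ?case
    using hpoly.hpoly_monomial[OF hpoly_monomial(1,2), of v] by blast
next
  case (hpoly_add k f g)
  then obtain Q Q' where Q: "hpoly k Q" "\<And>x. Q (D x) - D (Q x) = f x"
    and Q': "hpoly k Q'" "\<And>x. Q' (D x) - D (Q' x) = g x"
    by blast
  have "(Q (D x) + Q' (D x)) - D (Q x + Q' x) = f x + g x" for x
    using D unfolding Q(2)[symmetric] Q'(2)[symmetric] by (simp add: clinear_iff)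
  then show ?case
    using hpoly.hpoly_add[OF Q(1) Q'(1)] by blast
qed

text \<open>With degree at least 2 the Lipschitz constant on the ball carries a positive power of
  \<open>\<epsilon>\<close>, hence is at most \<open>L * \<epsilon>\<close>; the choice of
  \<open>\<epsilon>\<close> makes this at most 1/2.\<close>

lemma hpoly_contraction:
  assumes f: "hpoly k f" and k: "k \<ge> 2"
  obtains \<epsilon> where "0 < \<epsilon>" "\<epsilon> < 1"
    "\<And>x y. x \<in> ball 0 \<epsilon> \<Longrightarrow> y \<in> ball 0 \<epsilon> \<Longrightarrow> norm (f x - f y) \<le> norm (x - y) / 2"
proof -
  obtain j where j: "k = Suc (Suc j)" using k by (metis Suc_le_D numeral_2_eq_2 Suc_le_mono)
  obtain L where L: "L \<ge> 0"
    "\<And>M x y. norm x \<le> M \<Longrightarrow> norm y \<le> M \<Longrightarrow> norm (f x - f y) \<le> L * M ^ Suc j * norm (x - y)"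
    using hpoly_lipschitz[of "Suc j" f] f j by metis
  define \<epsilon> where "\<epsilon> = 1 / (2 * (L + 1))"
  have \<epsilon>: "0 < \<epsilon>" "\<epsilon> < 1" "L * \<epsilon> \<le> 1 / 2" using L(1) by (auto simp: \<epsilon>_def field_simps)
  have "norm (f x - f y) \<le> norm (x - y) / 2" if "x \<in> ball 0 \<epsilon>" "y \<in> ball 0 \<epsilon>" for x y
  proof -
    have "\<epsilon> ^ Suc j \<le> \<epsilon>" using \<epsilon> by (simp add: mult_left_le power_le_one)
    then have "L * \<epsilon> ^ Suc j \<le> 1 / 2" using \<epsilon>(3) mult_left_mono[OF _ L(1)] order_trans by blast
    then have "L * \<epsilon> ^ Suc j * norm (x - y) \<le> 1 / 2 * norm (x - y)"
      by (intro mult_right_mono) auto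
    then show ?thesis using L(2)[of x \<epsilon> y] that by simp
  qed
  then show ?thesis using that \<epsilon> by blast
qed

text \<open>Yields injectivity of \<open>x + Q x\<close> and the Lipschitz constant 2 of its
  inverse.\<close>

lemma perturbed_identity_expansive:
  assumes "norm (Q x - Q y) \<le> norm (x - y) / 2"
  shows "norm (x - y) \<le> 2 * norm ((x + Q x) - (y + Q y))"
  using norm_triangle_ineq4[of "(x + Q x) - (y + Q y)" "Q x - Q y"] assms by (simp add: algebra_simps)

text \<open>The inverse is the uniform limit of the polynomial Picard iterates
  \<open>w \<mapsto> y - Q w\<close>.\<close>

lemma perturbed_identity_inverse:
  fixes Q :: "'a \<Rightarrow> 'a"
  assumes Q: "polymap Q" "Q 0 = 0" and \<epsilon>: "\<epsilon> > 0"
    and contr: "\<And>x y. x \<in> ball 0 \<epsilon> \<Longrightarrow> y \<in> ball 0 \<epsilon> \<Longrightarrow> norm (Q x - Q y) \<le> norm (x - y) / 2"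
  defines "\<Phi> \<equiv> \<lambda>z. z + Q z"
  shows "inj_on \<Phi> (ball 0 \<epsilon>)" "ball 0 (\<epsilon> / 2) \<subseteq> \<Phi> ` ball 0 \<epsilon>"
    "poly_limit (\<epsilon> / 2) (inv_into (ball 0 \<epsilon>) \<Phi>)"
proof -
  show inj: "inj_on \<Phi> (ball 0 \<epsilon>)"
  proof (rule inj_onI)
    fix x y assume "x \<in> ball 0 \<epsilon>" "y \<in> ball 0 \<epsilon>" "\<Phi> x = \<Phi> y"
    then show "x = y"
      using perturbed_identity_expansive[of Q x y] contr[of x y] by (simp add: \<Phi>_def)
  qed
  have Qle: "norm (Q x) \<le> norm x / 2" if "norm x < \<epsilon>" for x
    using contr[of x 0] that \<epsilon> Q(2) by simp
  have ex: "\<exists>w. norm w \<le> 2 * norm y \<and> \<Phi> w = y" if y: "y \<in> ball 0 (\<epsilon> / 2)" for y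
  proof -
    \<comment> \<open>This ball is invariant because
      \<open>norm y + norm w / 2 \<le> 2 * norm y\<close> on it; being closed it is complete, and
      \<open>norm y < \<epsilon> / 2\<close> keeps it where \<open>contr\<close> holds.\<close>
    have sub: "cball 0 (2 * norm y) \<subseteq> ball 0 \<epsilon>" using y by auto
    have "\<exists>!w\<in>cball 0 (2 * norm y). y - Q w = w"
    proof (rule Banach_fix[where c = "1 / 2"])
      show "(\<lambda>w. y - Q w) ` cball 0 (2 * norm y) \<subseteq> cball 0 (2 * norm y)"
      proof (intro image_subsetI)
        fix w :: 'a assume w: "w \<in> cball 0 (2 * norm y)"
        then have "norm (Q w) \<le> norm w / 2" using y by (intro Qle) auto
        then show "y - Q w \<in> cball 0 (2 * norm y)"
          using w norm_triangle_ineq4[of y "Q w"] by simp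
      qed
      show "dist (y - Q x) (y - Q x') \<le> 1 / 2 * dist x x'"
        if "x \<in> cball 0 (2 * norm y)" "x' \<in> cball 0 (2 * norm y)" for x x'
        using contr[of x x'] that y by (auto simp: dist_norm norm_minus_commute)
      show "complete (cball (0 :: 'a) (2 * norm y))" by (simp add: complete_eq_closed)
      show "cball (0 :: 'a) (2 * norm y) \<noteq> {}" by simp
    qed simp_all
    then obtain w where "w \<in> cball 0 (2 * norm y)" "y - Q w = w" by blast
    then show ?thesis by (intro exI[of _ w]) (simp add: \<Phi>_def diff_eq_eq)
  qed
  show sub: "ball 0 (\<epsilon> / 2) \<subseteq> \<Phi> ` ball 0 \<epsilon>"
  proof (intro subsetI)
    fix y :: 'a assume y: "y \<in> ball 0 (\<epsilon> / 2)"
    then obtain w where "norm w \<le> 2 * norm y" "\<Phi> w = y" using ex by blast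
    then show "y \<in> \<Phi> ` ball 0 \<epsilon>" using y by (intro image_eqI[of _ _ w]) auto
  qed
  define \<Psi> where "\<Psi> = inv_into (ball 0 \<epsilon>) \<Phi>"
  define w where "w j y = ((\<lambda>x. y - Q x) ^^ j) 0" for j y
  have w_Suc: "w (Suc j) y = y - Q (w j y)" and w_0: "w 0 y = 0" for j y
    by (simp_all add: w_def)
  have w: "polymap (w j)" for j
  proof (induction j)
    case 0
    then show ?case using polymap_const[of 0] by (simp add: w_0[abs_def])
  next
    case (Suc j)
    show ?case
      unfolding w_Suc[abs_def] by (rule polymap_diff[OF polymap_id polymap_compose[OF Q(1) Suc]])
  qed
  \<comment> \<open>Each iteration halves the error, and the initial error
    \<open>norm (\<Psi> y)\<close> is below \<open>\<epsilon>\<close> for every \<open>y\<close>, so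
    convergence is uniform.\<close>
  have close: "norm (\<Psi> y - w j y) \<le> \<epsilon> * (1 / 2) ^ j" if y: "y \<in> ball 0 (\<epsilon> / 2)" for j y
  proof -
    have \<Psi>: "\<Psi> y \<in> ball 0 \<epsilon>" "\<Psi> y + Q (\<Psi> y) = y"
      using inv_into_into[OF subsetD[OF sub y]] f_inv_into_f[OF subsetD[OF sub y]]
      unfolding \<Psi>_def by (simp_all add: \<Phi>_def)
    have small: "norm (w j y) \<le> 2 * norm y" for j
    proof (induction j)
      case (Suc j)
      then have "norm (Q (w j y)) \<le> norm (w j y) / 2" using y by (intro Qle) auto
      then show ?case using Suc norm_triangle_ineq4[of y "Q (w j y)"] by (simp add: w_Suc)
    qed (simp add: w_0)
    show ?thesis
    proof (induction j)
      case 0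
      then show ?case using \<Psi>(1) by (simp add: w_0)
    next
      case (Suc j)
      have "\<Psi> y - w (Suc j) y = Q (w j y) - Q (\<Psi> y)"
        using \<Psi>(2) by (simp add: w_Suc algebra_simps)
      also have "norm \<dots> \<le> norm (w j y - \<Psi> y) / 2"
        using small[of j] y \<Psi>(1) by (intro contr) auto
      finally show ?case using Suc by (simp add: norm_minus_commute)
    qed
  qed
  show "poly_limit (\<epsilon> / 2) (inv_into (ball 0 \<epsilon>) \<Phi>)"
    unfolding poly_limit_def \<Psi>_def[symmetric]
  proof (intro allI impI)
    fix \<eta> :: real assume \<eta>: "\<eta> > 0"
    have "(\<lambda>N. \<epsilon> * (1 / 2) ^ N) \<longlonglongrightarrow> 0"
      using tendsto_mult_left[OF LIMSEQ_power_zero[of "1/2 :: real"], of \<epsilon>] by simp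
    then obtain N where "\<epsilon> * (1 / 2) ^ N < \<eta>"
      using order_tendstoD(2)[OF _ \<eta>] by (metis eventually_sequentially order_refl)
    then show "\<exists>p. polymap p \<and> (\<forall>x\<in>ball 0 (\<epsilon> / 2). norm (\<Psi> x - p x) < \<eta>)"
      using w[of N] close[of _ N] by (force intro: le_less_trans)
  qed
qed

text \<open>Phrased with the eigenvalues of \<open>D\<close> in place of Koopman eigenfunctions, and
  with \<open>T\<close> standing for the current map \<open>Ts m\<close>.\<close>

lemma normal_form_step:
  fixes T D R :: "'a \<Rightarrow> 'a"
  assumes D: "clinear D" "bounded_linear D"
    and eig: "\<And>i. i \<in> {1..n} \<Longrightarrow> D (e i) = lam i *\<^sub>C e i"
    and nonres: "\<And>j \<alpha>. j \<in> {1..n} \<Longrightarrow> (\<Sum>i=1..n. \<alpha> i) \<ge> 2 \<Longrightarrow> lam j \<noteq> (\<Prod>i=1..n. lam i ^ \<alpha> i)"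
    and m: "m \<ge> 1"
    and T: "\<forall>\<^sub>F x in nhds 0. T x = D x + R x"
    and R: "has_power_series_at_0 R" "(\<lambda>x. norm (R x)) \<in> O[nhds 0](\<lambda>x. norm x ^ (m + 1))"
  shows "\<exists>\<epsilon> Q \<Phi> R'. 0 < \<epsilon> \<and> \<epsilon> < 1 \<and>
    Q \<in> hom_polys (m + 1) \<and> \<Phi> = (\<lambda>z. z + Q z) \<and>
    bij_betw \<Phi> (ball 0 \<epsilon>) (\<Phi> ` ball 0 \<epsilon>) \<and>
    (\<forall>\<^sub>F z in nhds 0. z \<in> ball 0 \<epsilon> \<and> T (\<Phi> z) \<in> \<Phi> ` ball 0 \<epsilon> \<and>
      (inv_into (ball 0 \<epsilon>) \<Phi> \<circ> T \<circ> \<Phi>) z = D z + R' z) \<and>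
    has_power_series_at_0 R' \<and>
    (\<lambda>z. norm (R' z)) \<in> O[nhds 0](\<lambda>z. norm z ^ (m + 2))"
proof -
  obtain P C r where P: "hpoly (m + 1) P" and r: "r > 0" and C: "C \<ge> 0"
    and RP: "\<And>x. x \<in> ball 0 r \<Longrightarrow> norm (R x - P x) \<le> C * norm x ^ Suc (m + 1)"
    using power_series_leading_term[OF R] by metis
  obtain Q where Q: "hpoly (m + 1) Q" and QD: "\<And>x. Q (D x) - D (Q x) = P x"
    using homological_equation[of D lam, OF D(1) eig nonres P] m by auto
  obtain \<epsilon> where \<epsilon>: "0 < \<epsilon>" "\<epsilon> < 1"
    and contr: "\<And>x y. x \<in> ball 0 \<epsilon> \<Longrightarrow> y \<in> ball 0 \<epsilon> \<Longrightarrow> norm (Q x - Q y) \<le> norm (x - y) / 2"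
    using hpoly_contraction[OF Q] m by auto
  define \<Phi> where "\<Phi> = (\<lambda>z. z + Q z)"
  define \<Psi> where "\<Psi> = inv_into (ball 0 \<epsilon>) \<Phi>"
  have Q0: "Q 0 = 0" using hpoly_at_0[OF Q] by simp
  have pQ: "polymap Q" by (rule hpoly_imp_polymap[OF Q])
  have inj: "inj_on \<Phi> (ball 0 \<epsilon>)" and surj: "ball 0 (\<epsilon> / 2) \<subseteq> \<Phi> ` ball 0 \<epsilon>"
    and \<Psi>_limit: "poly_limit (\<epsilon> / 2) \<Psi>"
    using perturbed_identity_inverse[OF pQ Q0 \<epsilon>(1) contr] by (simp_all add: \<Phi>_def \<Psi>_def)
  have p\<Phi>: "polymap \<Phi>" unfolding \<Phi>_def by (rule polymap_add[OF polymap_id pQ])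
  have \<Phi>_le: "norm (\<Phi> z) \<le> 2 * norm z" if "z \<in> ball 0 \<epsilon>" for z
  proof -
    have "norm (Q z) \<le> norm z / 2" using contr[OF that, of 0] Q0 \<epsilon>(1) by simp
    then show ?thesis
      using norm_triangle_ineq[of z "Q z"] norm_ge_zero[of z] unfolding \<Phi>_def by linarith
  qed

  obtain K where K: "K > 0" "\<forall>\<^sub>F x in nhds 0. norm (R x) \<le> K * norm x ^ (m + 1)"
    using landau_o.bigE[OF R(2)] by (auto simp: norm_power)
  obtain B where B: "B > 0" "\<And>x. norm (D x) \<le> norm x * B"
    using bounded_linear.pos_bounded[OF D(2)] by blast
  obtain \<rho>1 where \<rho>1: "\<rho>1 > 0" "poly_limit \<rho>1 R"
    using power_series_imp_poly_limit[OF R(1)] by blast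
  obtain \<rho>2 where \<rho>2: "\<rho>2 > 0"
    "\<And>x. x \<in> ball 0 \<rho>2 \<Longrightarrow> T x = D x + R x \<and> norm (R x) \<le> K * norm x ^ (m + 1)"
    using eventually_conj[OF T K(2)] by (auto simp: eventually_nhds_metric dist_commute)
  obtain L where L: "L \<ge> 0"
    "\<And>M x y. norm x \<le> M \<Longrightarrow> norm y \<le> M \<Longrightarrow> norm (P x - P y) \<le> L * M ^ m * norm (x - y)"
    using hpoly_lipschitz[of m P] P by auto
  obtain L' where L': "L' \<ge> 0"
    "\<And>M x y. norm x \<le> M \<Longrightarrow> norm y \<le> M \<Longrightarrow> norm (Q x - Q y) \<le> L' * M ^ m * norm (x - y)"
    using hpoly_lipschitz[of m Q] Q by auto
  \<comment> \<open>The entries secure, in this order: decreasing powers, the leading term estimate,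
    approximation of \<open>R\<close> by polynomials, and \<open>T = D + R\<close> with the growth
    bound.\<close>
  define \<rho> where "\<rho> = min (min 1 r) (min \<rho>1 \<rho>2)"
  have \<rho>: "\<rho> > 0" "\<rho> \<le> 1" "\<rho> \<le> r" "\<rho> \<le> \<rho>1" "\<rho> \<le> \<rho>2"
    using r \<rho>1 \<rho>2 by (auto simp: \<rho>_def)
  \<comment> \<open>The bound \<open>\<rho> / 4\<close> puts \<open>\<Phi> z\<close> within
    \<open>\<rho> / 2\<close>, and the last entry puts \<open>T (\<Phi> z)\<close> within
    \<open>\<epsilon> / 4\<close>: both strictly inside the next map's ball, as
    \<open>poly_limit_compose\<close> requires.\<close>
  define s where "s = min (min \<epsilon> (\<rho> / 4)) (\<epsilon> / (8 * (B + K)))"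
  have BK: "8 * (B + K) > 0" using B K by simp
  then have s: "s > 0" "s \<le> \<epsilon>" "s \<le> \<rho> / 4" "s \<le> \<epsilon> / (8 * (B + K))"
    unfolding s_def using \<epsilon>(1) \<rho>(1) by (simp, linarith+)
  then have s_BK: "8 * (B + K) * s \<le> \<epsilon>"
    using pos_le_divide_eq[OF BK] by (simp add: mult.commute)
  have \<Phi>_small: "norm (\<Phi> z) \<le> \<rho> / 2" "\<Phi> z \<in> ball 0 \<rho>" if "z \<in> ball 0 s" for z
    using \<Phi>_le[of z] that s \<rho>(1) by auto
  have T\<Phi>: "T (\<Phi> z) = D (\<Phi> z) + R (\<Phi> z)" if "z \<in> ball 0 s" for z
    using \<rho>2(2)[of "\<Phi> z"] \<Phi>_small[OF that] \<rho>(5) by simp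
  have T_small: "norm (T (\<Phi> z)) \<le> \<epsilon> / 4" if z: "z \<in> ball 0 s" for z
  proof -
    have "norm (\<Phi> z) ^ (m + 1) \<le> norm (\<Phi> z)"
      using \<Phi>_small[OF z] \<rho>(2) by (simp add: mult_left_le power_le_one)
    then have "norm (R (\<Phi> z)) \<le> K * norm (\<Phi> z)"
      using \<rho>2(2)[of "\<Phi> z"] \<Phi>_small[OF z] \<rho>(5) K(1)
      by (meson less_le_trans mem_ball_0 mult_left_mono order_trans less_imp_le)
    then have "norm (T (\<Phi> z)) \<le> (B + K) * norm (\<Phi> z)"
      using norm_triangle_ineq[of "D (\<Phi> z)" "R (\<Phi> z)"] B(2)[of "\<Phi> z"]
      by (simp add: T\<Phi>[OF z] algebra_simps)
    also have "\<dots> \<le> (B + K) * (2 * s)"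
      using \<Phi>_le[of z] z s B K by (intro mult_left_mono) auto
    finally show ?thesis using s_BK by (simp add: algebra_simps)
  qed
  define R' where "R' = (\<lambda>z. \<Psi> (T (\<Phi> z)) - D z)"

  have "poly_limit s (\<lambda>z. R (\<Phi> z))"
    using \<rho> by (intro poly_limit_compose[OF poly_limit_mono[OF \<rho>1(2) \<rho>(4)]
        polymap_imp_poly_limit[OF p\<Phi>] _ \<Phi>_small(1)]) auto
  moreover have "polymap (\<lambda>z. D (\<Phi> z))"
    by (rule polymap_compose[OF clinear_imp_polymap[OF D(1)] p\<Phi>])
  ultimately have "poly_limit s (\<lambda>z. D (\<Phi> z) + R (\<Phi> z))"
    by (rule poly_limit_add[OF polymap_imp_poly_limit, rotated])
  then have "poly_limit s (\<lambda>z. T (\<Phi> z))"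
    by (rule poly_limit_cong) (simp add: T\<Phi>)
  then have "poly_limit s (\<lambda>z. \<Psi> (T (\<Phi> z)))"
    using \<epsilon> by (intro poly_limit_compose[OF \<Psi>_limit _ _ T_small]) auto
  from poly_limit_add[OF this polymap_imp_poly_limit[OF polymap_cscale[OF clinear_imp_polymap[OF D(1)], of "-1"]]]
  have "poly_limit s R'"
    unfolding R'_def by (simp add: scaleC_one)
  then have series: "has_power_series_at_0 R'"
    using s(1) by (rule poly_limit_imp_power_series)

  have range: "T (\<Phi> z) \<in> \<Phi> ` ball 0 \<epsilon>" if "z \<in> ball 0 s" for z
    using T_small[OF that] \<epsilon>(1) by (intro subsetD[OF surj]) simp
  \<comment> \<open>The leading 2 is the Lipschitz constant of the inverse; the summands estimate
    \<open>R - P\<close> at \<open>\<Phi> z\<close>, where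
    \<open>norm (\<Phi> z) \<le> 2 * norm z\<close>, and the change of \<open>P\<close> from
    \<open>z\<close> to \<open>\<Phi> z\<close>.\<close>
  define c where "c = 2 * (C * 2 ^ (m + 2) + L * 2 ^ m * L')"
  have order: "norm (R' z) \<le> c * norm z ^ (m + 2)" if z: "z \<in> ball 0 s" for z
  proof -
    have z\<epsilon>: "z \<in> ball 0 \<epsilon>" and z1: "norm z \<le> 1" using z s \<epsilon> by auto
    have \<Psi>: "\<Psi> (T (\<Phi> z)) \<in> ball 0 \<epsilon>" "\<Phi> (\<Psi> (T (\<Phi> z))) = T (\<Phi> z)"
      unfolding \<Psi>_def by (rule inv_into_into[OF range[OF z]], rule f_inv_into_f[OF range[OF z]])
    \<comment> \<open>\<open>D z\<close> must lie in the ball too, since it is compared with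
      \<open>\<Psi> (T (\<Phi> z))\<close> through \<open>\<Phi>\<close>.\<close>
    have "norm (D z) \<le> B * s" using B z by (simp add: mult.commute order_trans[OF B(2)] mult_left_mono)
    moreover have "B * s < \<epsilon>"
    proof -
      have "0 < K * s" "0 < B * s" using s(1) K(1) B(1) by simp_all
      moreover have "8 * (B * s) + 8 * (K * s) \<le> \<epsilon>" using s_BK by (simp add: algebra_simps)
      ultimately show ?thesis by linarith
    qed
    ultimately have Dz: "D z \<in> ball 0 \<epsilon>" by simp
    \<comment> \<open>The terms \<open>D z\<close> cancel, and the homological equation turns
      \<open>D (Q z) - Q (D z)\<close> into \<open>- P z\<close>.\<close>
    have "\<Phi> (\<Psi> (T (\<Phi> z))) - \<Phi> (D z) = R (\<Phi> z) - P z"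
      unfolding \<Psi>(2) QD[symmetric] unfolding T\<Phi>[OF z]
      using linear_add[OF bounded_linear.linear[OF D(2)], of z "Q z"] by (simp add: \<Phi>_def)
    then have R': "norm (R' z) \<le> 2 * norm (R (\<Phi> z) - P z)"
      using perturbed_identity_expansive[of Q "\<Psi> (T (\<Phi> z))" "D z"] contr[OF \<Psi>(1) Dz]
      by (simp add: R'_def \<Phi>_def)
    have split: "norm (R (\<Phi> z) - P z) \<le> norm (R (\<Phi> z) - P (\<Phi> z)) + norm (P (\<Phi> z) - P z)"
      using norm_triangle_ineq[of "R (\<Phi> z) - P (\<Phi> z)" "P (\<Phi> z) - P z"] by simp
    have tail: "norm (R (\<Phi> z) - P (\<Phi> z)) \<le> C * 2 ^ (m + 2) * norm z ^ (m + 2)"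
    proof -
      have "norm (R (\<Phi> z) - P (\<Phi> z)) \<le> C * norm (\<Phi> z) ^ Suc (m + 1)"
        using \<Phi>_small(2)[OF z] \<rho>(3) by (intro RP) auto
      also have "\<dots> \<le> C * (2 * norm z) ^ Suc (m + 1)"
        using \<Phi>_le[OF z\<epsilon>] C by (intro mult_left_mono power_mono) auto
      finally show ?thesis by (simp add: power_mult_distrib mult_ac)
    qed
    have shift: "norm (P (\<Phi> z) - P z) \<le> L * 2 ^ m * L' * norm z ^ (m + 2)"
    proof -
      have "norm (Q z) \<le> L' * norm z ^ m * norm z"
        using L'(2)[of z "norm z" 0] Q0 by simp
      moreover have "norm (P (\<Phi> z) - P z) \<le> L * (2 * norm z) ^ m * norm (Q z)"
        using L(2)[of "\<Phi> z" "2 * norm z" z] \<Phi>_le[OF z\<epsilon>] by (simp add: \<Phi>_def)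
      ultimately have "norm (P (\<Phi> z) - P z) \<le> L * (2 * norm z) ^ m * (L' * norm z ^ m * norm z)"
        using L(1) by (meson mult_left_mono mult_nonneg_nonneg norm_ge_zero order_trans
            zero_le_power zero_le_numeral)
      also have "\<dots> = L * 2 ^ m * L' * norm z ^ (2 * m + 1)"
        unfolding mult_2[of m] power_add power_one_right power_mult_distrib by (simp only: mult_ac)
      \<comment> \<open>Here \<open>2 * m + 1 \<ge> m + 2\<close> by \<open>m \<ge> 1\<close>, and
        \<open>norm z \<le> 1\<close>.\<close>
      also have "\<dots> \<le> L * 2 ^ m * L' * norm z ^ (m + 2)"
        using z1 m L(1) L'(1) by (intro mult_left_mono power_decreasing) auto
      finally show ?thesis .
    qed
    have "norm (R' z) \<le> 2 * (norm (R (\<Phi> z) - P (\<Phi> z)) + norm (P (\<Phi> z) - P z))"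
      by (rule order_trans[OF R' mult_left_mono[OF split]]) simp
    also have "\<dots> \<le> 2 * (C * 2 ^ (m + 2) * norm z ^ (m + 2) + L * 2 ^ m * L' * norm z ^ (m + 2))"
      by (intro mult_left_mono add_mono tail shift) simp
    finally show ?thesis by (simp only: c_def distrib_right mult.assoc)
  qed
  have near: "\<forall>\<^sub>F z in nhds (0::'a). z \<in> ball 0 s"
    using s(1) by (intro eventually_nhds_in_open) auto
  show ?thesis
  proof (intro exI conjI)
    show "\<forall>\<^sub>F z in nhds 0. z \<in> ball 0 \<epsilon> \<and> T (\<Phi> z) \<in> \<Phi> ` ball 0 \<epsilon> \<and>
        (inv_into (ball 0 \<epsilon>) \<Phi> \<circ> T \<circ> \<Phi>) z = D z + R' z"
      using near by eventually_elim (use range s(2) in \<open>auto simp: R'_def \<Psi>_def\<close>)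
    show "(\<lambda>z. norm (R' z)) \<in> O[nhds 0](\<lambda>z. norm z ^ (m + 2))"
      by (rule bigoI[of _ c], use near in eventually_elim) (use order in \<open>simp add: norm_power\<close>)
    show "bij_betw \<Phi> (ball 0 \<epsilon>) (\<Phi> ` ball 0 \<epsilon>)"
      using inj by (rule inj_on_imp_bij_betw)
    show "Q \<in> hom_polys (m + 1)" by (rule hpoly_imp_hom_polys[OF Q])
  qed (fact \<epsilon> \<Phi>_def series)+
qed

end

theorem proposition3p3:
  fixes T D :: "'a::{complex_normed_vector, banach} \<Rightarrow> 'a"
    and n m :: nat
    and e :: "nat \<Rightarrow> 'a" and lam :: "nat \<Rightarrow> complex" and \<phi> :: "nat \<Rightarrow> 'a \<Rightarrow> complex"
    and Ts :: "nat \<Rightarrow> 'a \<Rightarrow> 'a" and R :: "'a \<Rightarrow> 'a"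
  assumes "\<exists>B :: 'a set. finite B \<and> complex_vector.span B = UNIV"
    and "diffeomorphism T" and "T 0 = 0" and "has_power_series_at_0 T"
    and "has_cderivative_at T D 0"
    and "n = complex_vector.dim (UNIV :: 'a set)"
    and "eigenbasis D n e lam" and "\<forall>i\<in>{1..n}. lam i \<noteq> 0"
    and "dual_basis n e \<phi>"
    and "nonresonant_eigenfunctions (koopman D) n \<phi>"
    and "Ts 1 = T" and "m \<ge> 1"
    and "\<forall>\<^sub>F x in nhds 0. Ts m x = D x + R x"
    and "has_power_series_at_0 R"
    and "(\<lambda>x. norm (R x)) \<in> O[nhds 0](\<lambda>x. norm x ^ (m + 1))"
  shows "\<exists>\<epsilon> Q \<Phi> R'. 0 < \<epsilon> \<and> \<epsilon> < 1 \<and>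
    Q \<in> hom_polys (m + 1) \<and> \<Phi> = (\<lambda>z. z + Q z) \<and>
    bij_betw \<Phi> (ball 0 \<epsilon>) (\<Phi> ` ball 0 \<epsilon>) \<and>
    (\<forall>\<^sub>F z in nhds 0. z \<in> ball 0 \<epsilon> \<and> Ts m (\<Phi> z) \<in> \<Phi> ` ball 0 \<epsilon> \<and>
      (inv_into (ball 0 \<epsilon>) \<Phi> \<circ> Ts m \<circ> \<Phi>) z = D z + R' z) \<and>
    has_power_series_at_0 R' \<and>
    (\<lambda>z. norm (R' z)) \<in> O[nhds 0](\<lambda>z. norm z ^ (m + 2))"
proof -
  interpret dual_coordinates n e \<phi>
    using assms(7,9) by (intro dual_coordinatesI) (auto simp: eigenbasis_def)
  have D: "clinear D" "bounded_linear D"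
    using assms(5) by (auto simp: has_cderivative_at_def dest: has_derivative_bounded_linear)
  have eig: "D (e i) = lam i *\<^sub>C e i" if "i \<in> {1..n}" for i
    using assms(7) that by (simp add: eigenbasis_def)
  obtain mu where mu: "\<And>i. i \<in> {1..n} \<Longrightarrow> eigenfunction (koopman D) (mu i) (\<phi> i)"
    and nonres: "\<And>j \<alpha>. j \<in> {1..n} \<Longrightarrow> (\<Sum>i=1..n. \<alpha> i) \<ge> 2 \<Longrightarrow> mu j \<noteq> (\<Prod>i=1..n. mu i ^ \<alpha> i)"
    using assms(10) unfolding nonresonant_eigenfunctions_def by blast
  have mu_lam: "mu i = lam i" if i: "i \<in> {1..n}" for i
  proof -
    \<comment> \<open>At \<open>e i\<close> the functional \<open>\<phi> i\<close> equals 1, which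
      identifies the Koopman eigenvalue with that of \<open>D\<close>.\<close>
    have "\<phi> i (D (e i)) = mu i * \<phi> i (e i)"
      using mu[OF i] by (auto simp: eigenfunction_def koopman_def fun_eq_iff)
    then show ?thesis using i by (simp add: eig phi_scale phi_basis)
  qed
  have "lam j \<noteq> (\<Prod>i=1..n. lam i ^ \<alpha> i)" if "j \<in> {1..n}" "(\<Sum>i=1..n. \<alpha> i) \<ge> 2" for j \<alpha>
  proof -
    have "(\<Prod>i=1..n. mu i ^ \<alpha> i) = (\<Prod>i=1..n. lam i ^ \<alpha> i)"
      by (intro prod.cong) (simp_all add: mu_lam)
    then show ?thesis using nonres[OF that] mu_lam[OF that(1)] by simp
  qed
  from normal_form_step[OF D eig this assms(12-15)] show ?thesis .
qed

end
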